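(* Let $\Gamma$ be a canonical signed unicyclic graph whose unique cycle $C_g^\sigma$ has length $g$. (1) If $\Gamma$ is a cycle (i.e. $\Gamma=C_g^\sigma$), then $i_-(\Gamma)=\lceil g/2\rceil$ if and only if either $C_g^\sigma$ is balanced and $g\equiv 2,3\pmod 4$, or $C_g^\sigma$ is unbalanced and $g\equiv 0,1\pmod 4$. Suppose now $\Gamma$ is not a cycle. Let $v_1,\dots,v_k$ ($k\ge1$) be the major vertices, listed in cyclic order along $C_g^\sigma$, and let $l_1,\dots,l_k\ge 0$ be the numbers of vertices of $C_g^\sigma$ strictly between consecutive major vertices $v_j$ and $v_{j+1}$ (indices mod $k$; for $k=1$, $l_1=g-1$), so that $C_g^\sigma-\{v_1,\dots,v_k\}$ is a disjoint union of paths of orders $l_1,\dots,l_k$ (a path of order $0$ being empty) and $g=k+l_1+\cdots+l_k$. (2) If $g\equiv 1,3\pmod 4$, then $i_-(\Gamma)=\lceil g/2\rceil$ if and only if exactly one of $l_1,\dots,l_k$ is even. (3) If $g\equiv 0,2\pmod 4$, then $i_-(\Gamma)=\lceil g/2\rceil$ if and only if all of $l_1,\dots,l_k$ are odd.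
   Context: A signed graph $\Gamma=(G,\sigma)$ is a simple graph $G$ with a sign function $\sigma:E(G)\to\{+,-\}$; its adjacency matrix has $(u,v)$-entry $\sigma(uv)$ if $uv\in E(G)$, $0$ otherwise, and $i_-(\Gamma)$ is its number of negative eigenvalues. A cycle is balanced if the product of its edge signs is $+$, unbalanced otherwise. A signed unicyclic graph is a connected signed graph with exactly one cycle. It is called canonical if, with $C$ its unique cycle, every vertex not on $C$ is adjacent to exactly one vertex of $C$ and the vertices not on $C$ are pairwise nonadjacent (equivalently, every vertex is at distance at most $1$ from $C$, the vertices at distance $1$ form an independent set, and each has exactly one neighbour on $C$). A vertex of $C$ having at least one neighbour outside $C$ is called a major vertex; the major vertex together with its neighbours outside $C$ forms a pendant star. *)

theory Defs
  imports "Jordan_Normal_Form.Char_Poly"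
begin

definition signed_graph :: "nat \<Rightarrow> (nat \<Rightarrow> nat \<Rightarrow> bool) \<Rightarrow> (nat \<Rightarrow> nat \<Rightarrow> real) \<Rightarrow> bool" where
  "signed_graph n E s \<longleftrightarrow>
     (\<forall>i j. E i j \<longrightarrow> i < n \<and> j < n \<and> i \<noteq> j \<and> E j i \<and> s i j = s j i \<and> s i j \<in> {1, -1})"

definition adj_mat :: "nat \<Rightarrow> (nat \<Rightarrow> nat \<Rightarrow> bool) \<Rightarrow> (nat \<Rightarrow> nat \<Rightarrow> real) \<Rightarrow> real mat" where
  "adj_mat n E s = mat n n (\<lambda>(i, j). if E i j then s i j else 0)"

definition neg_inertia :: "real mat \<Rightarrow> nat" where
  "neg_inertia A = (\<Sum>x\<in>{x. x < 0 \<and> eigenvalue A x}. order x (char_poly A))"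

definition connected_graph :: "nat \<Rightarrow> (nat \<Rightarrow> nat \<Rightarrow> bool) \<Rightarrow> bool" where
  "connected_graph n E \<longleftrightarrow> n \<ge> 1 \<and> (\<forall>i<n. \<forall>j<n. E\<^sup>*\<^sup>* i j)"

definition cycle_list :: "nat \<Rightarrow> (nat \<Rightarrow> nat \<Rightarrow> bool) \<Rightarrow> nat list \<Rightarrow> bool" where
  "cycle_list n E c \<longleftrightarrow> distinct c \<and> length c \<ge> 3 \<and> set c \<subseteq> {..<n} \<and>
     (\<forall>i<length c. E (c ! i) (c ! ((i + 1) mod length c)))"

definition cyc_edges :: "nat list \<Rightarrow> nat set set" where
  "cyc_edges c = {{c ! i, c ! ((i + 1) mod length c)} | i. i < length c}"

definition unicyclic :: "nat \<Rightarrow> (nat \<Rightarrow> nat \<Rightarrow> bool) \<Rightarrow> bool" where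
  "unicyclic n E \<longleftrightarrow> connected_graph n E \<and> (\<exists>!F. \<exists>c. cycle_list n E c \<and> F = cyc_edges c)"

definition canonical_unicyclic :: "nat \<Rightarrow> (nat \<Rightarrow> nat \<Rightarrow> bool) \<Rightarrow> bool" where
  "canonical_unicyclic n E \<longleftrightarrow> unicyclic n E \<and>
     (\<forall>c. cycle_list n E c \<longrightarrow>
        (\<forall>v<n. v \<notin> set c \<longrightarrow> card {u \<in> set c. E v u} = 1) \<and>
        (\<forall>u<n. \<forall>v<n. u \<notin> set c \<longrightarrow> v \<notin> set c \<longrightarrow> \<not> E u v))"

definition balanced_cycle :: "(nat \<Rightarrow> nat \<Rightarrow> real) \<Rightarrow> nat list \<Rightarrow> bool" where
  "balanced_cycle s c \<longleftrightarrow> (\<Prod>i<length c. s (c ! i) (c ! ((i + 1) mod length c))) = 1"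

definition major_idx :: "nat \<Rightarrow> (nat \<Rightarrow> nat \<Rightarrow> bool) \<Rightarrow> nat list \<Rightarrow> nat set" where
  "major_idx n E c = {i. i < length c \<and> (\<exists>v<n. v \<notin> set c \<and> E (c ! i) v)}"

(* number of cycle vertices strictly between the major vertex at position i
   and the next major vertex along c (cyclically) *)
definition gap_len :: "nat set \<Rightarrow> nat \<Rightarrow> nat \<Rightarrow> nat" where
  "gap_len M g i = (LEAST d. 0 < d \<and> (i + d) mod g \<in> M) - 1"

end

theory Submission
  imports Defs "Jordan_Normal_Form.Spectral_Radius"
begin

text \<open>
  By the spectral theorem, the number of negative eigenvalues of a symmetric matrix is bounded above by
  the number of linear conditions that force its quadratic form to be nonnegative, and bounded below by
  a dual test. If every edge meets a vertex set \<open>T\<close>, the form vanishes where the coordinates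
  in \<open>T\<close> do, so there are at most \<open>card T\<close> negative eigenvalues; equality holds as
  soon as the block of the matrix between \<open>T\<close> and \<open>card T\<close> vertices outside
  \<open>T\<close> is invertible.

  If there are major vertices, let \<open>T\<close> consist of them and of every second vertex of each
  gap. Matching major vertices with a pendant neighbour and the others with their successor on the cycle
  gives a triangular block, and counting yields that twice the number of negative eigenvalues is
  \<open>g\<close> plus the number of even gaps.

  If the graph is a cycle, switching signs turns its form into twice the sum of \<open>y i * y (i + 1)\<close> over
  \<open>i < g\<close>, where \<open>y g = t * y 0\<close> and \<open>t\<close> is the product of the edge signs.
  Imposing \<open>y (2 * j) = (- 1) ^ j * y 0\<close> makes the form collapse, and the sign of
  \<open>t * (- 1) ^ (g div 2)\<close> decides whether the bound \<open>\<lceil>g / 2\<rceil>\<close> is attained.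
\<close>

section \<open>Orthogonal diagonalization of real symmetric matrices\<close>

text \<open>Over the complex numbers an eigenvalue \<open>l\<close> with eigenvector
  \<open>z\<close> exists. The Hermitian form at \<open>z\<close> equals \<open>l\<close> times the
  squared norm of \<open>z\<close> and is its own conjugate, so \<open>l\<close> is real. Then the
  real and imaginary parts of \<open>z\<close> both satisfy the eigenvector equation, and a nonzero
  one is normalized.\<close>

lemma real_symmetric_eigenvector_exists:
  fixes A :: "real mat"
  assumes A: "A \<in> carrier_mat n n" and sym: "transpose_mat A = A" and n: "0 < n"
  shows "\<exists>e v. v \<in> carrier_vec n \<and> v \<bullet> v = 1 \<and> A *\<^sub>v v = e \<cdot>\<^sub>v v"
proof -
  let ?C = "map_mat complex_of_real A"
  have C: "?C \<in> carrier_mat n n" using A by simp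
  obtain l where "eigenvalue ?C l"
    using spectrum_non_empty[OF C] n by (auto simp: spectrum_def)
  then obtain z where z: "z \<in> carrier_vec n" "z \<noteq> 0\<^sub>v n" "?C *\<^sub>v z = l \<cdot>\<^sub>v z"
    using A unfolding eigenvalue_def eigenvector_def by auto
  have row: "(\<Sum>j<n. of_real (A $$ (i,j)) * z $ j) = l * z $ i" if "i < n" for i
  proof -
    have "(?C *\<^sub>v z) $ i = (l \<cdot>\<^sub>v z) $ i" using z(3) by simp
    then show ?thesis using that A z(1)
      by (simp add: scalar_prod_def lessThan_atLeast0)
  qed
  have a_sym: "A $$ (i,j) = A $$ (j,i)" if "i < n" "j < n" for i j
    using that A sym by (metis carrier_matD index_transpose_mat(1))
  define S where "S = (\<Sum>i<n. \<Sum>j<n. cnj (z $ i) * of_real (A $$ (i,j)) * z $ j)"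
  define r where "r = (\<Sum>i<n. (cmod (z $ i))\<^sup>2)"
  have S: "S = l * of_real r"
  proof -
    have "S = (\<Sum>i<n. cnj (z $ i) * (l * z $ i))"
      unfolding S_def by (intro sum.cong refl) (simp add: row[symmetric] sum_distrib_left mult.assoc)
    also have "\<dots> = (\<Sum>i<n. l * of_real ((cmod (z $ i))\<^sup>2))"
      by (intro sum.cong refl) (simp add: complex_norm_square mult_ac del: of_real_power)
    finally show ?thesis by (simp add: r_def sum_distrib_left)
  qed
  have "cnj S = (\<Sum>i<n. \<Sum>j<n. cnj (z $ j) * of_real (A $$ (j,i)) * z $ i)"
    unfolding S_def by (simp, intro sum.cong refl) (simp add: a_sym)
  also have "\<dots> = S" unfolding S_def by (rule sum.swap)
  finally have "cnj S = S" .
  moreover have "r \<noteq> 0"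
  proof
    assume "r = 0"
    then have "\<forall>i<n. z $ i = 0" unfolding r_def by (subst (asm) sum_nonneg_eq_0_iff) auto
    then have "z = 0\<^sub>v n" using z(1) by (intro eq_vecI) auto
    with z(2) show False ..
  qed
  ultimately have "cnj l = l" by (simp add: S)
  then have "l \<in> \<real>" by (simp add: Reals_cnj_iff)
  then obtain e where l: "l = of_real e" by (auto elim: Reals_cases)
  have "\<exists>w. w \<in> carrier_vec n \<and> w \<noteq> 0\<^sub>v n \<and> A *\<^sub>v w = e \<cdot>\<^sub>v w"
  proof -
    have main: "A *\<^sub>v vec n (\<lambda>i. f (z $ i)) = e \<cdot>\<^sub>v vec n (\<lambda>i. f (z $ i))"
      if f: "f = Re \<or> f = Im" for f
    proof (rule eq_vecI)
      fix i assume "i < dim_vec (e \<cdot>\<^sub>v vec n (\<lambda>i. f (z $ i)))"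
      then have i: "i < n" by simp
      have "f (\<Sum>j<n. of_real (A $$ (i,j)) * z $ j) = f (l * z $ i)" using row[OF i] by simp
      then show "(A *\<^sub>v vec n (\<lambda>i. f (z $ i))) $ i = (e \<cdot>\<^sub>v vec n (\<lambda>i. f (z $ i))) $ i"
        using f i A by (auto simp: scalar_prod_def lessThan_atLeast0 l)
    qed (use A in auto)
    show ?thesis
    proof (cases "vec n (\<lambda>i. Re (z $ i)) = 0\<^sub>v n")
      case False
      then show ?thesis using main[of Re] by (intro exI[of _ "vec n (\<lambda>i. Re (z $ i))"]) auto
    next
      case True
      have "vec n (\<lambda>i. Im (z $ i)) \<noteq> 0\<^sub>v n"
      proof
        assume *: "vec n (\<lambda>i. Im (z $ i)) = 0\<^sub>v n"
        have "z $ i = 0" if "i < n" for i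
          using arg_cong[OF True, of "\<lambda>v. v $ i"] arg_cong[OF *, of "\<lambda>v. v $ i"] that
          by (simp add: complex_eq_iff)
        then have "z = 0\<^sub>v n" using z(1) by (intro eq_vecI) auto
        with z(2) show False ..
      qed
      then show ?thesis using main[of Im] by (intro exI[of _ "vec n (\<lambda>i. Im (z $ i))"]) auto
    qed
  qed
  then obtain w where w: "w \<in> carrier_vec n" "w \<noteq> 0\<^sub>v n" "A *\<^sub>v w = e \<cdot>\<^sub>v w" by blast
  have "0 < w \<bullet> w"
    using conjugate_square_greater_0_vec[OF w(1)] w(2) by (simp add: conjugate_vec_def conjugate_real_def)
  then show ?thesis using w A
    by (intro exI[of _ e] exI[of _ "(1 / sqrt (w \<bullet> w)) \<cdot>\<^sub>v w"])
      (auto simp: mult_mat_vec smult_smult_assoc mult.commute)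
qed

text \<open>The reflection in the hyperplane orthogonal to \<open>u = v - e\<close>, with
  \<open>e\<close> the first unit vector, exchanges \<open>e\<close> and \<open>v\<close> because
  both have length 1.\<close>

lemma householder_reflection:
  fixes v :: "real vec"
  assumes v: "v \<in> carrier_vec n" and unit: "v \<bullet> v = 1" and n: "0 < n"
  shows "\<exists>W \<in> carrier_mat n n. transpose_mat W = W \<and> W * W = 1\<^sub>m n \<and> W *\<^sub>v unit_vec n 0 = v"
proof -
  define u where "u = (\<lambda>i. v $ i - (if i = 0 then 1 else 0))"
  define q where "q = (\<Sum>i<n. u i * u i)"
  \<comment> \<open>If \<open>v\<close> is already the first unit vector, then \<open>q = 0\<close>.
    Division by zero gives \<open>k = 0\<close> and \<open>W\<close> is the identity, so the same
    formula serves.\<close>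
  define k where "k = 2 / q"
  define W where "W = mat n n (\<lambda>(i,j). (if i = j then 1 else 0) - k * u i * u j)"
  have vv: "(\<Sum>i<n. v $ i * v $ i) = 1"
    using unit v by (simp add: scalar_prod_def lessThan_atLeast0)
  have q: "q = 2 - 2 * v $ 0"
  proof -
    have "q = (\<Sum>i<n. v $ i * v $ i - 2 * (if i = 0 then v $ 0 else 0) + (if i = 0 then 1 else 0))"
      unfolding q_def u_def by (intro sum.cong refl) (auto simp: algebra_simps)
    also have "\<dots> = 2 - 2 * v $ 0"
      using n by (simp add: sum.distrib sum_subtractf vv sum_distrib_left[symmetric])
    finally show ?thesis .
  qed
  have kq: "k * k * q = 2 * k" unfolding k_def by simp
  have W: "W \<in> carrier_mat n n" unfolding W_def by simp
  have "W * W = 1\<^sub>m n"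
  proof (rule eq_matI)
    fix i j assume "i < dim_row (1\<^sub>m n :: real mat)" "j < dim_col (1\<^sub>m n :: real mat)"
    then have ij: "i < n" "j < n" by auto
    have "(W * W) $$ (i,j) = (\<Sum>l<n. ((if i = l then 1 else 0) - k * u i * u l) * ((if l = j then 1 else 0) - k * u l * u j))"
      using ij by (simp add: W_def scalar_prod_def lessThan_atLeast0)
    also have "\<dots> = (\<Sum>l<n. (if i = l then (if i = j then 1 else 0) else 0) - (if i = l then k * u i * u j else 0)
        - (if l = j then k * u i * u j else 0) + k * k * u i * u j * (u l * u l))"
      by (intro sum.cong refl) (auto simp: algebra_simps)
    also have "\<dots> = (if i = j then 1 else 0) - k * u i * u j - k * u i * u j + k * k * u i * u j * q"
      using ij by (simp add: sum.distrib sum_subtractf q_def sum_distrib_left)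
    also have "\<dots> = (if i = j then 1 else 0) + (k * k * q - 2 * k) * (u i * u j)"
      by (simp add: algebra_simps)
    finally show "(W * W) $$ (i,j) = 1\<^sub>m n $$ (i,j)" using ij by (simp add: kq)
  qed (auto simp: W_def)
  moreover have "W *\<^sub>v unit_vec n 0 = v"
  proof (rule eq_vecI)
    fix i assume "i < dim_vec v"
    then have i: "i < n" using v by simp
    have "(W *\<^sub>v unit_vec n 0) $ i = (if i = 0 then 1 else 0) - k * u i * u 0"
      using i n W by (simp add: W_def)
    also have "\<dots> = v $ i"
    proof (cases "q = 0")
      case True
      then have "u i = 0" using i unfolding q_def by (subst (asm) sum_nonneg_eq_0_iff) auto
      then show ?thesis by (auto simp: u_def)
    next
      case False
      have "k * u 0 = - 1" unfolding k_def u_def using False q by (simp add: field_simps)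
      then have "k * u i * u 0 = - u i" by (metis mult.assoc mult.commute mult_minus1)
      then show ?thesis by (simp add: u_def)
    qed
    finally show "(W *\<^sub>v unit_vec n 0) $ i = v $ i" .
  qed (use v W in auto)
  moreover have "transpose_mat W = W" by (rule eq_matI) (auto simp: W_def)
  ultimately show ?thesis using W by blast
qed

definition diag_of :: "nat \<Rightarrow> (nat \<Rightarrow> real) \<Rightarrow> real mat" where
  "diag_of n e = mat n n (\<lambda>(i, j). if i = j then e i else 0)"

lemma diag_of_carrier [simp]: "diag_of n e \<in> carrier_mat n n"
  by (simp add: diag_of_def)

lemma diag_of_dims [simp]: "dim_row (diag_of n e) = n" "dim_col (diag_of n e) = n"
  by (simp_all add: diag_of_def)

lemma diag_of_Suc:
  "diag_of (Suc n) (case_nat a e) =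
     four_block_mat (diag_of 1 (\<lambda>_. a)) (0\<^sub>m 1 n) (0\<^sub>m n 1) (diag_of n e)"
  by (rule eq_matI) (auto simp: diag_of_def split: nat.split)

text \<open>Deflation: conjugating with the reflection \<open>W\<close> that sends the first unit
  vector to a unit eigenvector clears the first column of the matrix outside the diagonal. Symmetry
  clears the first row too, and the remaining block is diagonalized by induction.\<close>

theorem real_symmetric_orthogonal_diagonalization:
  fixes A :: "real mat"
  assumes "A \<in> carrier_mat n n" and "transpose_mat A = A"
  shows "\<exists>P e. P \<in> carrier_mat n n \<and> transpose_mat P * P = 1\<^sub>m n \<and> A * P = P * diag_of n e"
  using assms
proof (induction n arbitrary: A)
  case 0
  then show ?case by (intro exI[of _ "1\<^sub>m 0"] exI[of _ "\<lambda>_. 0"]) (auto simp: diag_of_def)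
next
  case (Suc n)
  note A = Suc.prems(1) and sym = Suc.prems(2)
  let ?N = "Suc n"
  obtain a v where v: "v \<in> carrier_vec ?N" "v \<bullet> v = 1" "A *\<^sub>v v = a \<cdot>\<^sub>v v"
    using real_symmetric_eigenvector_exists[OF A sym] by auto
  obtain W where W: "W \<in> carrier_mat ?N ?N" "transpose_mat W = W" "W * W = 1\<^sub>m ?N"
      "W *\<^sub>v unit_vec ?N 0 = v"
    using householder_reflection[OF v(1,2)] by auto
  note assoc = assoc_mult_mat[of _ ?N ?N _ ?N _ ?N]
  define B where "B = W * A * W"
  have B: "B \<in> carrier_mat ?N ?N" unfolding B_def using W A by simp
  have B_sym: "transpose_mat B = B"
    unfolding B_def using W A sym by (simp add: transpose_mult[of _ ?N ?N _ ?N] assoc)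
  \<comment> \<open>\<open>W\<close> is an involution, so it also carries \<open>v\<close> back to
    the first unit vector.\<close>
  have "W *\<^sub>v v = (W * W) *\<^sub>v unit_vec ?N 0"
    using W by (subst assoc_mult_mat_vec[of _ ?N ?N _ ?N]) auto
  then have Wv: "W *\<^sub>v v = unit_vec ?N 0" by (simp add: W)
  have B0: "B *\<^sub>v unit_vec ?N 0 = a \<cdot>\<^sub>v unit_vec ?N 0"
  proof -
    have "B *\<^sub>v unit_vec ?N 0 = W *\<^sub>v (A *\<^sub>v (W *\<^sub>v unit_vec ?N 0))"
      unfolding B_def using W A by (simp add: assoc_mult_mat_vec[of _ ?N ?N _ ?N])
    also have "\<dots> = a \<cdot>\<^sub>v (W *\<^sub>v v)"
      using W v by (simp add: mult_mat_vec[of _ ?N ?N])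
    finally show ?thesis by (simp add: Wv)
  qed
  have col0: "B $$ (i, 0) = (if i = 0 then a else 0)" if "i < ?N" for i
    using arg_cong[OF B0, of "\<lambda>w. w $ i"] that B by (simp split: if_splits)
  have row0: "B $$ (0, i) = (if i = 0 then a else 0)" if "i < ?N" for i
    using col0[OF that] B_sym B that by (metis carrier_matD index_transpose_mat(1) zero_less_Suc)
  define C where "C = mat n n (\<lambda>(i, j). B $$ (Suc i, Suc j))"
  have C: "C \<in> carrier_mat n n" by (simp add: C_def)
  have "B $$ (i, j) = B $$ (j, i)" if "i < ?N" "j < ?N" for i j
    using B_sym B that by (metis carrier_matD index_transpose_mat(1))
  then have "transpose_mat C = C" by (intro eq_matI) (auto simp: C_def)
  from Suc.IH[OF C this] obtain P e where
    P: "P \<in> carrier_mat n n" "transpose_mat P * P = 1\<^sub>m n" "C * P = P * diag_of n e" by blast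
  have B_block: "B = four_block_mat (diag_of 1 (\<lambda>_. a)) (0\<^sub>m 1 n) (0\<^sub>m n 1) C"
    using B by (intro eq_matI) (auto simp: col0 row0 C_def diag_of_def)
  define R where "R = four_block_mat (1\<^sub>m 1) (0\<^sub>m 1 n) (0\<^sub>m n 1) P"
  have R: "R \<in> carrier_mat ?N ?N"
    unfolding R_def using four_block_carrier_mat[of "1\<^sub>m 1" 1 1 P n n] P by simp
  have B_R: "B * R = R * diag_of ?N (case_nat a e)"
    unfolding B_block R_def diag_of_Suc using P C
    by (subst (1 2) mult_four_block_mat[where ?nr1.0 = 1 and ?nr2.0 = n and ?n1.0 = 1 and ?n2.0 = n
          and ?nc1.0 = 1 and ?nc2.0 = n]) auto
  have "transpose_mat R = four_block_mat (1\<^sub>m 1) (0\<^sub>m 1 n) (0\<^sub>m n 1) (transpose_mat P)"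
    unfolding R_def using P by (subst transpose_four_block_mat[of _ 1 1 _ n _ n]) auto
  then have "transpose_mat R * R = four_block_mat (1\<^sub>m 1) (0\<^sub>m 1 n) (0\<^sub>m n 1) (1\<^sub>m n)"
    unfolding R_def using P
    by (simp, subst mult_four_block_mat[where ?nr1.0 = 1 and ?nr2.0 = n and ?n1.0 = 1 and ?n2.0 = n
          and ?nc1.0 = 1 and ?nc2.0 = n]) auto
  also have "\<dots> = 1\<^sub>m ?N" by (rule eq_matI) auto
  finally have R_orth: "transpose_mat R * R = 1\<^sub>m ?N" .
  have "transpose_mat (W * R) * (W * R) = transpose_mat R * (W * W) * R"
    using W(1,2) R by (simp add: transpose_mult[of _ ?N ?N _ ?N] assoc)
  then have orth: "transpose_mat (W * R) * (W * R) = 1\<^sub>m ?N"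
    using W(3) R R_orth by simp
  have "A * (W * R) = (W * W) * A * (W * R)" using W(3) A by simp
  also have "\<dots> = W * (B * R)"
    unfolding B_def using W(1) A R by (simp add: assoc)
  also have "\<dots> = W * R * diag_of ?N (case_nat a e)"
    unfolding B_R using W(1) R by (simp add: assoc)
  finally show ?case using orth W(1) R
    by (intro exI[of _ "W * R"] exI[of _ "case_nat a e"]) auto
qed

section \<open>Negative eigenvalues counted on the diagonal\<close>

lemma order_prod_linear_factors:
  fixes x :: "'a :: idom"
  shows "order x (\<Prod>a\<leftarrow>es. [:- a, 1:]) = length (filter (\<lambda>a. a = x) es)"
proof (induction es)
  case (Cons b es)
  have "(\<Prod>a\<leftarrow>es. [:- a, 1:]) \<noteq> 0" by (auto simp: prod_list_zero_iff)
  then have "order x (\<Prod>a\<leftarrow>b # es. [:- a, 1:]) = order x [:- b, 1:] + order x (\<Prod>a\<leftarrow>es. [:- a, 1:])"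
    by (simp only: list.map prod_list.Cons) (rule order_mult, simp del: mult_pCons_left)
  then show ?case using Cons.IH by (simp add: order_linear')
qed (auto simp: order_0I)

text \<open>Similarity preserves the characteristic polynomial, which for the diagonal matrix splits
  into the factors with roots \<open>e j\<close>. The order at a root is the number of indices
  carrying it, and these index sets are disjoint for distinct roots.\<close>

lemma neg_inertia_diagonalized:
  assumes A: "A \<in> carrier_mat n n" and P: "P \<in> carrier_mat n n"
    and orth: "transpose_mat P * P = 1\<^sub>m n" and AP: "A * P = P * diag_of n e"
  shows "neg_inertia A = card {j. j < n \<and> e j < 0}"
proof -
  let ?T = "transpose_mat P"
  have T: "?T \<in> carrier_mat n n" using P by simp
  have inv: "P * ?T = 1\<^sub>m n" by (rule mat_mult_left_right_inverse[OF T P orth])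
  have "A = A * P * ?T" using A P T inv by (simp add: assoc_mult_mat[of _ n n _ n _ n])
  then have "similar_mat A (diag_of n e)"
    using A P T inv orth AP by (intro similar_matI[of _ _ P ?T n]) auto
  then have "char_poly A = char_poly (diag_of n e)" by (rule char_poly_similar)
  also have "\<dots> = (\<Prod>a\<leftarrow>diag_mat (diag_of n e). [:- a, 1:])"
    by (rule char_poly_upper_triangular[of _ n]) (auto simp: diag_of_def)
  also have "diag_mat (diag_of n e) = map e [0..<n]"
    by (auto simp: diag_mat_def diag_of_def)
  finally have cp: "char_poly A = (\<Prod>a\<leftarrow>map e [0..<n]. [:- a, 1:])" .
  have ev: "eigenvalue A x \<longleftrightarrow> x \<in> e ` {..<n}" for x
    unfolding eigenvalue_root_char_poly[OF A] cp by (auto simp: poly_prod_list prod_list_zero_iff)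
  have "neg_inertia A = (\<Sum>x\<in>{x. x < 0 \<and> x \<in> e ` {..<n}}. card {j. j < n \<and> e j = x})"
    unfolding neg_inertia_def ev cp order_prod_linear_factors
    by (intro sum.cong refl) (auto simp: length_filter_map length_filter_conv_card intro!: arg_cong[of _ _ card])
  also have "\<dots> = card (\<Union>x\<in>{x. x < 0 \<and> x \<in> e ` {..<n}}. {j. j < n \<and> e j = x})"
    by (subst card_UN_disjoint) auto
  also have "(\<Union>x\<in>{x. x < 0 \<and> x \<in> e ` {..<n}}. {j. j < n \<and> e j = x}) = {j. j < n \<and> e j < 0}"
    by auto
  finally show ?thesis .
qed

section \<open>Bounds for the number of negative eigenvalues\<close>

definition linear_functional :: "((nat \<Rightarrow> real) \<Rightarrow> real) \<Rightarrow> bool" where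
  "linear_functional F \<longleftrightarrow> (\<forall>t x y. F (\<lambda>i. t * x i + y i) = t * F x + F y)"

text \<open>A dimension count by elimination. Dropping one coordinate of \<open>T\<close> still
  leaves more coordinates than functionals in \<open>\<F>\<close>, so the induction hypothesis
  yields two independent solutions: \<open>x\<close> with \<open>x t1\<close> nonzero, and a nonzero
  \<open>y\<close> with \<open>y t1 = 0\<close>. A combination of them is annihilated by the new
  functional \<open>G\<close>.\<close>

lemma linear_functionals_common_zero:
  assumes "finite \<F>" and "\<And>F. F \<in> \<F> \<Longrightarrow> linear_functional F"
    and "finite T" and "card \<F> < card T"
  shows "\<exists>x. (\<forall>F\<in>\<F>. F x = 0) \<and> (\<forall>t. t \<notin> T \<longrightarrow> x t = 0) \<and> (\<exists>t\<in>T. x t \<noteq> 0)"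
  using assms
proof (induction \<F> arbitrary: T rule: finite_induct)
  case empty
  then obtain t where "t \<in> T" by (metis card.empty card_gt_0_iff ex_in_conv)
  then show ?case by (intro exI[of _ "\<lambda>i. if i = t then 1 else 0"]) auto
next
  case (insert G \<F>)
  have lin: "linear_functional G" "\<And>F. F \<in> \<F> \<Longrightarrow> linear_functional F" using insert.prems by auto
  have smaller: "card \<F> < card (T - {t})" if "t \<in> T" for t
    using insert that by (simp add: card_Diff_singleton)
  have IH: "\<exists>x. (\<forall>F\<in>\<F>. F x = 0) \<and> (\<forall>u. u \<notin> T - {t} \<longrightarrow> x u = 0) \<and> (\<exists>u\<in>T - {t}. x u \<noteq> 0)"
    if "t \<in> T" for t
    using insert.IH[OF lin(2) _ smaller[OF that]] insert.prems(2) by blast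
  obtain t0 where "t0 \<in> T" using insert.prems by (metis card.empty equals0I not_less_zero)
  from IH[OF this] obtain x t1 where
    x: "\<forall>F\<in>\<F>. F x = 0" "\<forall>u. u \<notin> T \<longrightarrow> x u = 0" "t1 \<in> T" "x t1 \<noteq> 0" by blast
  from IH[OF x(3)] obtain y where
    y: "\<forall>F\<in>\<F>. F y = 0" "\<forall>u. u \<notin> T \<longrightarrow> y u = 0" "y t1 = 0" "\<exists>u\<in>T. y u \<noteq> 0" by blast
  show ?case
  proof (cases "G y = 0")
    case True
    then show ?thesis using y by auto
  next
    case False
    define z where "z = (\<lambda>i. (- G x / G y) * y i + x i)"
    have "F z = 0" if F: "F \<in> insert G \<F>" for F
    proof -
      have "F z = (- G x / G y) * F y + F x"
        using insert.prems(1)[OF F] unfolding z_def linear_functional_def by blast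
      then show ?thesis using x(1) y(1) False F by (cases "F = G") auto
    qed
    then have "\<forall>F\<in>insert G \<F>. F z = 0" by blast
    moreover have "z t1 \<noteq> 0" using x y by (simp add: z_def)
    ultimately show ?thesis using x y by (intro exI[of _ z]) (auto simp: z_def)
  qed
qed

definition mat_app :: "real mat \<Rightarrow> nat \<Rightarrow> (nat \<Rightarrow> real) \<Rightarrow> nat \<Rightarrow> real" where
  "mat_app A n x i = (\<Sum>j<n. A $$ (i, j) * x j)"

definition quad_form :: "real mat \<Rightarrow> nat \<Rightarrow> (nat \<Rightarrow> real) \<Rightarrow> real" where
  "quad_form A n x = (\<Sum>i<n. x i * mat_app A n x i)"

text \<open>\<open>S\<close> turns coefficients with respect to an orthonormal eigenbasis into
  ordinary coordinates. Vectors are functions on all naturals, so \<open>S\<close> is set to 0 from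
  \<open>n\<close> on. In these coefficients the form is diagonal, the matrix scales by
  \<open>e\<close>, and the last property is injectivity.\<close>

lemma eigen_coordinates:
  assumes A: "A \<in> carrier_mat n n" and sym: "transpose_mat A = A"
  obtains S :: "(nat \<Rightarrow> real) \<Rightarrow> nat \<Rightarrow> real" and e where
    "neg_inertia A = card {j. j < n \<and> e j < 0}"
    and "\<And>t a b. S (\<lambda>i. t * a i + b i) = (\<lambda>i. t * S a i + S b i)"
    and "\<And>a i. n \<le> i \<Longrightarrow> S a i = 0"
    and "\<And>a. quad_form A n (S a) = (\<Sum>j<n. e j * (a j)\<^sup>2)"
    and "\<And>a i. i < n \<Longrightarrow> mat_app A n (S a) i = S (\<lambda>j. e j * a j) i"
    and "\<And>a. (\<And>i. i < n \<Longrightarrow> S a i = 0) \<Longrightarrow> \<forall>j<n. a j = 0"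
proof -
  obtain P e where P: "P \<in> carrier_mat n n" "transpose_mat P * P = 1\<^sub>m n" "A * P = P * diag_of n e"
    using real_symmetric_orthogonal_diagonalization[OF A sym] by blast
  define S where "S = (\<lambda>a i. if i < n then \<Sum>j<n. P $$ (i, j) * a j else 0)"
  have orth: "(\<Sum>i<n. P $$ (i, j) * P $$ (i, k)) = (if j = k then 1 else 0)" if "j < n" "k < n" for j k
    using arg_cong[OF P(2), of "\<lambda>M. M $$ (j, k)"] that P(1)
    by (simp add: scalar_prod_def lessThan_atLeast0)
  have eig: "(\<Sum>k<n. A $$ (i, k) * P $$ (k, j)) = P $$ (i, j) * e j" if "i < n" "j < n" for i j
    using arg_cong[OF P(3), of "\<lambda>M. M $$ (i, j)"] that P(1) A
    by (simp add: scalar_prod_def lessThan_atLeast0 diag_of_def if_distrib cong: if_cong)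
  have app: "mat_app A n (S a) i = S (\<lambda>j. e j * a j) i" if "i < n" for a i
  proof -
    have "mat_app A n (S a) i = (\<Sum>k<n. \<Sum>j<n. A $$ (i, k) * P $$ (k, j) * a j)"
      by (simp add: mat_app_def S_def sum_distrib_left mult.assoc)
    also have "\<dots> = (\<Sum>j<n. \<Sum>k<n. A $$ (i, k) * P $$ (k, j) * a j)" by (rule sum.swap)
    also have "\<dots> = (\<Sum>j<n. P $$ (i, j) * (e j * a j))"
      using that by (intro sum.cong refl) (simp add: sum_distrib_right[symmetric] eig)
    finally show ?thesis using that by (simp add: S_def)
  qed
  have coord: "(\<Sum>i<n. P $$ (i, l) * S a i) = a l" if "l < n" for a l
  proof -
    have "(\<Sum>i<n. P $$ (i, l) * S a i) = (\<Sum>i<n. \<Sum>j<n. P $$ (i, l) * P $$ (i, j) * a j)"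
      by (simp add: S_def sum_distrib_left mult.assoc)
    also have "\<dots> = (\<Sum>j<n. \<Sum>i<n. P $$ (i, l) * P $$ (i, j) * a j)" by (rule sum.swap)
    also have "\<dots> = (\<Sum>j<n. if l = j then a j else 0)"
      using that by (intro sum.cong refl) (simp add: sum_distrib_right[symmetric] orth)
    finally show ?thesis using that by simp
  qed
  have "quad_form A n (S a) = (\<Sum>j<n. e j * (a j)\<^sup>2)" for a
  proof -
    have "quad_form A n (S a) = (\<Sum>i<n. \<Sum>j<n. P $$ (i, j) * a j * S (\<lambda>j. e j * a j) i)"
      by (simp add: quad_form_def app) (simp add: S_def sum_distrib_right)
    also have "\<dots> = (\<Sum>j<n. \<Sum>i<n. P $$ (i, j) * a j * S (\<lambda>j. e j * a j) i)" by (rule sum.swap)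
    also have "\<dots> = (\<Sum>j<n. a j * (\<Sum>i<n. P $$ (i, j) * S (\<lambda>j. e j * a j) i))"
      by (simp add: sum_distrib_left mult_ac)
    also have "\<dots> = (\<Sum>j<n. e j * (a j)\<^sup>2)"
      by (intro sum.cong refl) (simp add: coord power2_eq_square)
    finally show ?thesis .
  qed
  moreover have "S (\<lambda>i. t * a i + b i) = (\<lambda>i. t * S a i + S b i)" for t a b
    by (auto simp: S_def sum.distrib sum_distrib_left algebra_simps)
  moreover have "\<forall>j<n. a j = 0" if "\<And>i. i < n \<Longrightarrow> S a i = 0" for a
  proof (intro allI impI)
    fix j assume "j < n"
    from coord[OF this, of a] show "a j = 0" by (simp add: that)
  qed
  moreover have "S a i = 0" if "n \<le> i" for a i using that by (simp add: S_def)
  ultimately show thesis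
    using that[of e S] neg_inertia_diagonalized[OF A P] app by blast
qed

text \<open>With more negative eigenvalues than conditions, some nonzero combination of the
  corresponding eigenvectors would satisfy every condition, yet the form is negative there.\<close>

lemma neg_inertia_le:
  assumes A: "A \<in> carrier_mat n n" and sym: "transpose_mat A = A"
    and fin: "finite \<F>" and lin: "\<And>F. F \<in> \<F> \<Longrightarrow> linear_functional F"
    and nonneg: "\<And>x. (\<And>F. F \<in> \<F> \<Longrightarrow> F x = 0) \<Longrightarrow> (\<And>i. n \<le> i \<Longrightarrow> x i = 0) \<Longrightarrow> 0 \<le> quad_form A n x"
  shows "neg_inertia A \<le> card \<F>"
proof (rule ccontr)
  assume *: "\<not> neg_inertia A \<le> card \<F>"
  obtain S e where S: "neg_inertia A = card {j. j < n \<and> e j < 0}"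
    "\<And>t a b. S (\<lambda>i. t * a i + b i) = (\<lambda>i. t * S a i + S b i)"
    "\<And>a i. n \<le> i \<Longrightarrow> S a i = 0"
    "\<And>a. quad_form A n (S a) = (\<Sum>j<n. e j * (a j)\<^sup>2)"
    by (rule eigen_coordinates[OF A sym]) blast
  let ?G = "(\<lambda>F a. F (S a)) ` \<F>"
  have "card ?G < card {j. j < n \<and> e j < 0}"
    using * S(1) card_image_le[OF fin, of "\<lambda>F a. F (S a)"] by linarith
  moreover have "linear_functional G" if "G \<in> ?G" for G
    using that lin by (auto simp: linear_functional_def S(2))
  ultimately obtain a where a: "\<forall>G\<in>?G. G a = 0" "\<forall>t. t \<notin> {j. j < n \<and> e j < 0} \<longrightarrow> a t = 0"
      "\<exists>t\<in>{j. j < n \<and> e j < 0}. a t \<noteq> 0"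
    using linear_functionals_common_zero[of ?G "{j. j < n \<and> e j < 0}"] fin by auto
  then obtain t where t: "t < n" "e t < 0" "a t \<noteq> 0" by auto
  have "(\<Sum>j<n. e j * (a j)\<^sup>2) < (\<Sum>j<n. 0)"
  proof (rule sum_strict_mono_ex1)
    show "\<forall>j\<in>{..<n}. e j * (a j)\<^sup>2 \<le> 0"
      using a(2) by (force simp: mult_le_0_iff)
    show "\<exists>j\<in>{..<n}. e j * (a j)\<^sup>2 < 0" using t by (auto simp: mult_less_0_iff)
  qed simp
  moreover have "0 \<le> quad_form A n (S a)" using a(1) S(3) by (intro nonneg) auto
  ultimately show False by (simp add: S(4))
qed

text \<open>Test vectors are taken from the span of the eigenvectors to nonnegative eigenvalues; there the
  form vanishes only on the kernel of the matrix, which is the last hypothesis of the test.\<close>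

lemma neg_inertia_ge:
  assumes A: "A \<in> carrier_mat n n" and sym: "transpose_mat A = A"
    and fin: "finite \<F>" and lin: "\<And>F. F \<in> \<F> \<Longrightarrow> linear_functional F"
    and definite: "\<And>x. (\<And>F. F \<in> \<F> \<Longrightarrow> F x = 0) \<Longrightarrow> (\<And>i. n \<le> i \<Longrightarrow> x i = 0) \<Longrightarrow>
      0 \<le> quad_form A n x \<Longrightarrow> (quad_form A n x = 0 \<Longrightarrow> \<forall>i<n. mat_app A n x i = 0) \<Longrightarrow>
      \<forall>i<n. x i = 0"
  shows "n \<le> neg_inertia A + card \<F>"
proof (rule ccontr)
  assume *: "\<not> n \<le> neg_inertia A + card \<F>"
  obtain S e where S: "neg_inertia A = card {j. j < n \<and> e j < 0}"
    "\<And>t a b. S (\<lambda>i. t * a i + b i) = (\<lambda>i. t * S a i + S b i)"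
    "\<And>a i. n \<le> i \<Longrightarrow> S a i = 0"
    "\<And>a. quad_form A n (S a) = (\<Sum>j<n. e j * (a j)\<^sup>2)"
    "\<And>a i. i < n \<Longrightarrow> mat_app A n (S a) i = S (\<lambda>j. e j * a j) i"
    "\<And>a. (\<And>i. i < n \<Longrightarrow> S a i = 0) \<Longrightarrow> \<forall>j<n. a j = 0"
    by (rule eigen_coordinates[OF A sym]) blast
  let ?G = "(\<lambda>F a. F (S a)) ` \<F>" and ?T = "{j. j < n \<and> \<not> e j < 0}"
  have "card ({j. j < n \<and> e j < 0} \<union> ?T) = card {j. j < n \<and> e j < 0} + card ?T"
    by (rule card_Un_disjoint) auto
  moreover have "{j. j < n \<and> e j < 0} \<union> ?T = {..<n}" by auto
  ultimately have "card ?G < card ?T"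
    using * S(1) card_image_le[OF fin, of "\<lambda>F a. F (S a)"] by simp
  moreover have "linear_functional G" if "G \<in> ?G" for G
    using that lin by (auto simp: linear_functional_def S(2))
  ultimately obtain a where a: "\<forall>G\<in>?G. G a = 0" "\<forall>t. t \<notin> ?T \<longrightarrow> a t = 0" "\<exists>t\<in>?T. a t \<noteq> 0"
    using linear_functionals_common_zero[of ?G ?T] fin by auto
  have terms: "0 \<le> e j * (a j)\<^sup>2" for j
    using a(2) by (cases "j \<in> ?T") auto
  have zero: "S (\<lambda>_. 0) i = 0" for i
    using fun_cong[OF S(2)[of "-1" "\<lambda>_. 0" "\<lambda>_. 0"], of i] by simp
  have "\<forall>i<n. S a i = 0"
  proof (rule definite)
    show "F (S a) = 0" if "F \<in> \<F>" for F using a(1) that by auto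
    show "0 \<le> quad_form A n (S a)" unfolding S(4) by (intro sum_nonneg terms)
    \<comment> \<open>The form at \<open>S a\<close> is a sum of nonnegative terms. If it vanishes,
      every \<open>e j * a j\<close> does, so the matrix annihilates \<open>S a\<close>.\<close>
    assume "quad_form A n (S a) = 0"
    then have "\<forall>j<n. e j * (a j)\<^sup>2 = 0" unfolding S(4) using terms
      by (subst (asm) sum_nonneg_eq_0_iff) auto
    then have "e j * a j = 0" for j using a(2) by (cases "j < n") auto
    then have "(\<lambda>j. e j * a j) = (\<lambda>_. 0)" by (rule ext)
    then show "\<forall>i<n. mat_app A n (S a) i = 0" using zero by (simp add: S(5))
  qed (use S(3) in auto)
  then have "\<forall>j<n. a j = 0" by (intro S(6)) auto
  then show False using a(3) by auto
qed

section \<open>Vertex covers and gaps\<close>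

lemma linear_functional_coordinate [simp]: "linear_functional (\<lambda>x. x v)"
  by (simp add: linear_functional_def)

lemma adj_mat_carrier [simp]: "adj_mat n E s \<in> carrier_mat n n"
  by (simp add: adj_mat_def)

lemma transpose_adj_mat:
  assumes "signed_graph n E s"
  shows "transpose_mat (adj_mat n E s) = adj_mat n E s"
  using assms by (intro eq_matI) (auto simp: adj_mat_def signed_graph_def)

lemma mat_app_adj_mat:
  assumes "signed_graph n E s" and "v < n"
  shows "mat_app (adj_mat n E s) n x v = (\<Sum>u | E v u. s v u * x u)"
proof -
  have "mat_app (adj_mat n E s) n x v = (\<Sum>u<n. if E v u then s v u * x u else 0)"
    unfolding mat_app_def using assms(2) by (intro sum.cong) (auto simp: adj_mat_def)
  also have "\<dots> = (\<Sum>u\<in>{u\<in>{..<n}. E v u}. s v u * x u)" by (rule sum.inter_filter[symmetric]) simp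
  also have "{u\<in>{..<n}. E v u} = {u. E v u}" using assms(1) by (auto simp: signed_graph_def)
  finally show ?thesis .
qed

definition vertex_cover :: "(nat \<Rightarrow> nat \<Rightarrow> bool) \<Rightarrow> nat set \<Rightarrow> bool" where
  "vertex_cover E T \<longleftrightarrow> (\<forall>u v. E u v \<longrightarrow> u \<in> T \<or> v \<in> T)"

lemma quad_form_vertex_cover:
  assumes "vertex_cover E T" and "\<And>v. v \<in> T \<Longrightarrow> x v = 0"
  shows "quad_form (adj_mat n E s) n x = 0"
proof -
  have "x u * (adj_mat n E s $$ (u, v) * x v) = 0" if "u < n" "v < n" for u v
    using assms that by (auto simp: adj_mat_def vertex_cover_def)
  then show ?thesis
    unfolding quad_form_def mat_app_def sum_distrib_left by (intro sum.neutral ballI) simp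
qed

text \<open>The conditions are the vanishing of the coordinates in \<open>T\<close>: each term of
  the form belongs to an edge and has a factor from \<open>T\<close>.\<close>

lemma neg_inertia_le_vertex_cover:
  assumes "signed_graph n E s" and "vertex_cover E T" and "finite T"
  shows "neg_inertia (adj_mat n E s) \<le> card T"
proof -
  let ?F = "(\<lambda>v (x :: nat \<Rightarrow> real). x v) ` T"
  have "neg_inertia (adj_mat n E s) \<le> card ?F"
  proof (rule neg_inertia_le[OF adj_mat_carrier transpose_adj_mat[OF assms(1)]])
    fix x :: "nat \<Rightarrow> real" assume "\<And>F. F \<in> ?F \<Longrightarrow> F x = 0"
    then have "x v = 0" if "v \<in> T" for v using that by blast
    then show "0 \<le> quad_form (adj_mat n E s) n x"
      using quad_form_vertex_cover[OF assms(2)] by simp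
  qed (use assms(3) in auto)
  also have "\<dots> \<le> card T" by (rule card_image_le[OF assms(3)])
  finally show ?thesis .
qed

text \<open>The hypothesis \<open>inj\<close> says that the block with rows \<open>T\<close> and
  columns \<open>U\<close> has trivial kernel. A vector supported on \<open>U\<close> vanishes on
  \<open>T\<close>, so its form is 0. The lower bound test then needs only kernel vectors, and for
  these the rows in \<open>T\<close> force the vector to be 0. Being supported on \<open>U\<close>
  costs \<open>n - card U\<close> conditions.\<close>

lemma neg_inertia_eq_vertex_cover:
  assumes sg: "signed_graph n E s" and cover: "vertex_cover E T"
    and T: "T \<subseteq> {..<n}" and U: "U \<subseteq> {..<n}" and TU: "T \<inter> U = {}" and card: "card U = card T"
    and inj: "\<And>x. (\<And>v. v \<notin> U \<Longrightarrow> x v = 0) \<Longrightarrow>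
      (\<And>v. v \<in> T \<Longrightarrow> (\<Sum>u | E v u. s v u * x u) = 0) \<Longrightarrow> \<forall>v\<in>U. x v = 0"
  shows "neg_inertia (adj_mat n E s) = card T"
proof (rule antisym)
  show "neg_inertia (adj_mat n E s) \<le> card T"
    using neg_inertia_le_vertex_cover[OF sg cover] T finite_subset by blast
  let ?F = "(\<lambda>v (x :: nat \<Rightarrow> real). x v) ` ({..<n} - U)"
  have "n \<le> neg_inertia (adj_mat n E s) + card ?F"
  proof (rule neg_inertia_ge[OF adj_mat_carrier transpose_adj_mat[OF sg]])
    fix x :: "nat \<Rightarrow> real"
    assume F: "\<And>F. F \<in> ?F \<Longrightarrow> F x = 0" and supp: "\<And>i. n \<le> i \<Longrightarrow> x i = 0"
      and ker: "quad_form (adj_mat n E s) n x = 0 \<Longrightarrow> \<forall>i<n. mat_app (adj_mat n E s) n x i = 0"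
    have x: "x v = 0" if "v \<notin> U" for v
      using F[of "\<lambda>x. x v"] supp[of v] that by (cases "v < n") auto
    then have "quad_form (adj_mat n E s) n x = 0"
      using TU by (intro quad_form_vertex_cover[OF cover]) auto
    from ker[OF this] have "(\<Sum>u | E v u. s v u * x u) = 0" if "v \<in> T" for v
      using mat_app_adj_mat[OF sg] T that by force
    from inj[OF x this] x show "\<forall>i<n. x i = 0" by blast
  qed auto
  also have "card ?F \<le> n - card T"
    using card_image_le[of "{..<n} - U" "\<lambda>v (x :: nat \<Rightarrow> real). x v"] U card
    by (simp add: card_Diff_subset finite_subset)
  finally show "card T \<le> neg_inertia (adj_mat n E s)"
    using card_mono[OF _ T] by simp
qed

section \<open>Distances to the next major position along the cycle\<close>

text \<open>This is \<open>gap_len\<close> before the subtraction of 1, which makes the recursion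
  along the cycle clean. Since \<open>d\<close> is positive, a single major position has distance
  \<open>g\<close> to itself.\<close>

definition next_dist :: "nat set \<Rightarrow> nat \<Rightarrow> nat \<Rightarrow> nat" where
  "next_dist M g i = (LEAST d. 0 < d \<and> (i + d) mod g \<in> M)"

context
  fixes M :: "nat set" and g :: nat
  assumes M: "M \<subseteq> {..<g}" "M \<noteq> {}"
begin

lemma next_dist_ex:
  assumes "i < g"
  shows "\<exists>d\<le>g. 0 < d \<and> (i + d) mod g \<in> M"
proof -
  obtain m where m: "m \<in> M" "m < g" using M by blast
  show ?thesis
  proof (cases "i < m")
    case True
    then show ?thesis using m by (intro exI[of _ "m - i"]) auto
  next
    case False
    then show ?thesis using m assms by (intro exI[of _ "m + g - i"]) auto
  qed
qed

lemma next_dist_bounds: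
  assumes "i < g"
  shows "0 < next_dist M g i" "next_dist M g i \<le> g"
proof -
  obtain d where d: "d \<le> g" "0 < d \<and> (i + d) mod g \<in> M" using next_dist_ex[OF assms] by blast
  show "0 < next_dist M g i" unfolding next_dist_def using LeastI[of "\<lambda>d. 0 < d \<and> (i + d) mod g \<in> M", OF d(2)] by blast
  show "next_dist M g i \<le> g" unfolding next_dist_def using d(1) Least_le[of "\<lambda>d. 0 < d \<and> (i + d) mod g \<in> M", OF d(2)] by linarith
qed

lemma next_dist_rec:
  assumes "i < g"
  shows "next_dist M g i = (if Suc i mod g \<in> M then 1 else Suc (next_dist M g (Suc i mod g)))"
proof -
  obtain d where d: "0 < d \<and> (i + d) mod g \<in> M" using next_dist_ex[OF assms] by blast
  have "next_dist M g i = Suc (LEAST m. (i + Suc m) mod g \<in> M)"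
    unfolding next_dist_def
    using Least_Suc[of "\<lambda>d. 0 < d \<and> (i + d) mod g \<in> M", OF d] by simp
  also have "(\<lambda>m. (i + Suc m) mod g \<in> M) = (\<lambda>m. (Suc i mod g + m) mod g \<in> M)"
    by (simp add: mod_add_left_eq)
  finally have *: "next_dist M g i = Suc (LEAST m. (Suc i mod g + m) mod g \<in> M)" .
  show ?thesis
  proof (cases "Suc i mod g \<in> M")
    case True
    then have "(LEAST m. (Suc i mod g + m) mod g \<in> M) = 0" by (intro Least_eq_0) simp
    then show ?thesis using * True by simp
  next
    case False
    \<comment> \<open>The shift 0 is ruled out because the successor is not in \<open>M\<close>;
      this restores the positivity condition of \<open>next_dist\<close>.\<close>
    then have "(\<lambda>m. (Suc i mod g + m) mod g \<in> M) = (\<lambda>m. 0 < m \<and> (Suc i mod g + m) mod g \<in> M)"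
      by (intro ext) (metis add_0_right mod_mod_trivial not_gr_zero)
    then show ?thesis using * False by (simp add: next_dist_def)
  qed
qed

lemma bij_betw_Suc_mod: "bij_betw (\<lambda>i. Suc i mod g) {..<g} {..<g}"
proof -
  have g: "0 < g" using M by auto
  have "inj_on (\<lambda>i. Suc i mod g) {..<g}"
    by (rule inj_onI) (auto simp: mod_Suc split: if_splits)
  moreover have "(\<lambda>i. Suc i mod g) ` {..<g} \<subseteq> {..<g}" using g by auto
  ultimately show ?thesis by (metis bij_betw_def endo_inj_surj finite_lessThan)
qed

text \<open>Every second vertex of a gap is counted backwards from the next major vertex, because
  \<^const>\<open>gap_len\<close> looks forward.\<close>

definition cover_idx :: "nat set" where
  "cover_idx = M \<union> {i. i < g \<and> i \<notin> M \<and> even (next_dist M g i)}"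

text \<open>A position at even distance has a successor outside \<open>M\<close> at odd distance,
  and conversely. Hence rotation by one matches all positions at even distance with the positions
  outside \<open>M\<close> at odd distance, which are exactly those outside the cover. A major
  position has an even gap when its distance is odd, and these positions are the surplus in the
  count.\<close>

lemma card_cover_idx:
  "2 * card cover_idx = g + card {i \<in> M. even (gap_len M g i)}"
proof -
  let ?Ev = "{i. i < g \<and> even (next_dist M g i)}"
  let ?O = "{i. i < g \<and> i \<notin> M \<and> odd (next_dist M g i)}"
  let ?E' = "{i. i < g \<and> i \<notin> M \<and> even (next_dist M g i)}"
  let ?nx = "\<lambda>i. Suc i mod g"
  have finM: "finite M" using M(1) finite_subset by blast
  have image: "?nx ` ?Ev = ?O"
  proof (intro equalityI subsetI)
    fix j assume "j \<in> ?nx ` ?Ev"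
    then obtain i where i: "i < g" "even (next_dist M g i)" "j = ?nx i" by auto
    then show "j \<in> ?O" using next_dist_rec[OF i(1)] by (auto split: if_splits)
  next
    fix j assume j: "j \<in> ?O"
    then obtain i where i: "i < g" "j = ?nx i"
      using bij_betw_imp_surj_on[OF bij_betw_Suc_mod] by (metis (mono_tags, lifting) imageE lessThan_iff mem_Collect_eq)
    then show "j \<in> ?nx ` ?Ev" using j next_dist_rec[OF i(1)] by auto
  qed
  have inj: "inj_on ?nx ?Ev"
    by (rule inj_on_subset[OF bij_betw_imp_inj_on[OF bij_betw_Suc_mod]]) auto
  have "card ?O = card ?Ev" using card_image[OF inj] unfolding image .
  moreover have "card ?Ev = card ?E' + card {i \<in> M. even (next_dist M g i)}"
  proof -
    have "?Ev = ?E' \<union> {i \<in> M. even (next_dist M g i)}" using M by auto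
    then have "card ?Ev = card (?E' \<union> {i \<in> M. even (next_dist M g i)})" by (rule arg_cong)
    also have "\<dots> = card ?E' + card {i \<in> M. even (next_dist M g i)}"
      using finM by (intro card_Un_disjoint) auto
    finally show ?thesis .
  qed
  moreover have "g = card M + card ?E' + card ?O"
  proof -
    have "{..<g} = (M \<union> ?E') \<union> ?O" using M by auto
    then have "g = card ((M \<union> ?E') \<union> ?O)" by (metis card_lessThan)
    also have "\<dots> = card (M \<union> ?E') + card ?O" using finM by (intro card_Un_disjoint) auto
    also have "card (M \<union> ?E') = card M + card ?E'" using finM by (intro card_Un_disjoint) auto
    finally show ?thesis .
  qed
  moreover have "card M = card {i \<in> M. even (next_dist M g i)} + card {i \<in> M. odd (next_dist M g i)}"
  proof -
    have "M = {i \<in> M. even (next_dist M g i)} \<union> {i \<in> M. odd (next_dist M g i)}" by auto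
    then have "card M = card ({i \<in> M. even (next_dist M g i)} \<union> {i \<in> M. odd (next_dist M g i)})"
      by (rule arg_cong)
    also have "\<dots> = card {i \<in> M. even (next_dist M g i)} + card {i \<in> M. odd (next_dist M g i)}"
      using finM by (intro card_Un_disjoint) auto
    finally show ?thesis .
  qed
  moreover have "{i \<in> M. even (gap_len M g i)} = {i \<in> M. odd (next_dist M g i)}"
  proof -
    have "even (gap_len M g i) \<longleftrightarrow> odd (next_dist M g i)" if "i \<in> M" for i
      using next_dist_bounds(1)[of i] that M unfolding gap_len_def next_dist_def[symmetric] by auto
    then show ?thesis by blast
  qed
  moreover have "card cover_idx = card M + card ?E'"
    unfolding cover_idx_def using finM by (intro card_Un_disjoint) auto
  ultimately show ?thesis by simp
qed

end

section \<open>Sums of products of neighbouring terms\<close>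

lemma sum_consecutive_products:
  fixes y :: "nat \<Rightarrow> real"
  shows "(\<Sum>i<2 * h. y i * y (Suc i)) = (\<Sum>j<h. y (2 * j + 1) * (y (2 * j) + y (2 * j + 2)))"
  by (induction h) (simp_all add: algebra_simps)

text \<open>Grouping the products around odd indices, each group contains the sum of two consecutive
  even-indexed values, which cancel. Only what touches the index \<open>m\<close> survives: one
  product for odd \<open>m\<close>, the group around \<open>m - 1\<close> for even
  \<open>m\<close>.\<close>

lemma sum_alternating_evens:
  fixes y :: "nat \<Rightarrow> real"
  assumes even_vals: "\<And>j. 2 * j < m \<Longrightarrow> y (2 * j) = (- 1) ^ j * y 0" and wrap: "y m = t * y 0" and m: "0 < m"
  shows "(\<Sum>i<m. y i * y (Suc i)) =
    (if odd m then t * (- 1) ^ (m div 2) * (y 0)\<^sup>2 else (t + (- 1) ^ (m div 2 - 1)) * y (m - 1) * y 0)"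
proof (cases "odd m")
  case True
  define h where "h = m div 2"
  then have mh: "m = Suc (2 * h)" using True by presburger
  have "(\<Sum>j<h. y (2 * j + 1) * (y (2 * j) + y (2 * j + 2))) = 0"
  proof (intro sum.neutral ballI)
    fix j assume "j \<in> {..<h}"
    then have "2 * j < m" "2 * Suc j < m" using mh by auto
    from even_vals[OF this(1)] even_vals[OF this(2)]
    show "y (2 * j + 1) * (y (2 * j) + y (2 * j + 2)) = 0" by simp
  qed
  then have "(\<Sum>i<m. y i * y (Suc i)) = y (2 * h) * y m"
    by (simp add: mh sum_consecutive_products)
  also have "\<dots> = t * (- 1) ^ h * (y 0)\<^sup>2"
    using even_vals[of h] wrap mh by (simp add: power2_eq_square)
  finally show ?thesis using True by (simp add: h_def)
next
  case False
  \<comment> \<open>One group fewer than \<open>m div 2\<close>: the last one involves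
    \<open>y m\<close>, which is governed by \<open>wrap\<close> and need not continue the
    alternation.\<close>
  define h where "h = m div 2 - 1"
  then have mh: "m = 2 * Suc h" using False m by presburger
  have "(\<Sum>j<h. y (2 * j + 1) * (y (2 * j) + y (2 * j + 2))) = 0"
  proof (intro sum.neutral ballI)
    fix j assume "j \<in> {..<h}"
    then have "2 * j < m" "2 * Suc j < m" using mh by auto
    from even_vals[OF this(1)] even_vals[OF this(2)]
    show "y (2 * j + 1) * (y (2 * j) + y (2 * j + 2)) = 0" by simp
  qed
  then have "(\<Sum>i<m. y i * y (Suc i)) = y (2 * h + 1) * (y (2 * h) + y m)"
    unfolding mh by (subst sum_consecutive_products) simp
  also have "\<dots> = (t + (- 1) ^ h) * y (m - 1) * y 0"
    using even_vals[of h] wrap mh by (simp add: algebra_simps)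
  finally show ?thesis using False by (simp add: h_def)
qed

section \<open>Absence of chords\<close>

text \<open>The segment \<open>d\<close> of \<open>c\<close> from position \<open>i\<close> to
  position \<open>j\<close> is closed to a cycle by the given edge. Uniqueness forces
  \<open>d\<close> and \<open>c\<close> to have the same edges, so that edge joins cyclically
  consecutive positions of \<open>c\<close>.\<close>

lemma unicyclic_chord_closes_cycle:
  assumes uni: "unicyclic n E" and cyc: "cycle_list n E c"
    and ij: "i < j" "j < length c" and E: "E (c ! j) (c ! i)"
  shows "j = Suc i \<or> (i = 0 \<and> Suc j = length c)"
proof (cases "j = Suc i")
  case False
  let ?g = "length c"
  define d where "d = take (Suc j - i) (drop i c)"
  have len: "length d = Suc j - i" using ij by (simp add: d_def)
  have nth: "d ! k = c ! (i + k)" if "k < length d" for k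
    using that ij by (simp add: d_def)
  have c: "distinct c" "3 \<le> ?g" "set c \<subseteq> {..<n}" "\<forall>k<?g. E (c ! k) (c ! ((k + 1) mod ?g))"
    using cyc by (auto simp: cycle_list_def)
  have "cycle_list n E d"
    unfolding cycle_list_def
  proof (intro conjI allI impI)
    show "distinct d" using c(1) by (simp add: d_def)
    show "3 \<le> length d" using len False ij by simp
    show "set d \<subseteq> {..<n}" using c(3) unfolding d_def by (meson in_set_dropD in_set_takeD subset_eq)
    fix k assume k: "k < length d"
    show "E (d ! k) (d ! ((k + 1) mod length d))"
    proof (cases "k + 1 < length d")
      case True
      then have "i + k + 1 < ?g" using len ij by simp
      then show ?thesis using c(4)[rule_format, of "i + k"] True k by (simp add: nth)
    next
      case False
      then have "k + 1 = length d" using k by simp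
      moreover from this have "i + k = j" using len ij by simp
      ultimately show ?thesis using E nth[of 0] nth[OF k] by (cases d) auto
    qed
  qed
  then have "cyc_edges d = cyc_edges c" using uni cyc unfolding unicyclic_def by blast
  moreover have "{c ! j, c ! i} \<in> cyc_edges d"
  proof -
    have "length d - 1 < length d" "(length d - 1 + 1) mod length d = 0" using len ij
      by (auto simp: Suc_diff_le)
    moreover have "d ! (length d - 1) = c ! j" "d ! 0 = c ! i" using nth len ij by auto
    ultimately show ?thesis unfolding cyc_edges_def by (metis (mono_tags, lifting) mem_Collect_eq)
  qed
  ultimately obtain k where k: "k < ?g" "{c ! j, c ! i} = {c ! k, c ! ((k + 1) mod ?g)}"
    unfolding cyc_edges_def by auto
  have k': "(k + 1) mod ?g < ?g" using k(1) by (intro mod_less_divisor) linarith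
  have "(j = k \<and> i = (k + 1) mod ?g) \<or> (j = (k + 1) mod ?g \<and> i = k)"
    using k(2) nth_eq_iff_index_eq[OF c(1)] k(1) k' ij by (auto simp: doubleton_eq_iff)
  then show ?thesis using ij k(1) by (auto simp: mod_Suc split: if_splits)
qed simp

section \<open>Canonical unicyclic graphs\<close>

context
  fixes n :: nat and E :: "nat \<Rightarrow> nat \<Rightarrow> bool" and s :: "nat \<Rightarrow> nat \<Rightarrow> real" and c :: "nat list"
    and g :: nat
  assumes sg: "signed_graph n E s" and can: "canonical_unicyclic n E"
    and cyc: "cycle_list n E c" and g: "g = length c"
begin

lemma cycle_facts:
  "distinct c" "3 \<le> g" "set c \<subseteq> {..<n}" "\<And>i. i < g \<Longrightarrow> E (c ! i) (c ! (Suc i mod g))"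
  using cyc by (auto simp: cycle_list_def g)

lemma E_sym: "E u v \<Longrightarrow> E v u"
  using sg by (auto simp: signed_graph_def)

lemma sign_nonzero: "E u v \<Longrightarrow> s u v \<noteq> 0"
  using sg by (force simp: signed_graph_def)

lemma nth_cycle_eq: "i < g \<Longrightarrow> j < g \<Longrightarrow> c ! i = c ! j \<longleftrightarrow> i = j"
  using nth_eq_iff_index_eq[OF cycle_facts(1)] by (simp add: g)

lemma nth_cycle_mem [simp]: "i < g \<Longrightarrow> c ! i \<in> set c"
  by (simp add: g)

lemma cycle_edge_consecutive:
  assumes "i < g" "j < g" "E (c ! i) (c ! j)"
  shows "j = Suc i mod g \<or> i = Suc j mod g"
proof -
  have uni: "unicyclic n E" using can by (simp add: canonical_unicyclic_def)
  have "i \<noteq> j" using assms sg by (auto simp: signed_graph_def)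
  then consider "i < j" | "j < i" by linarith
  then show ?thesis
  proof cases
    case 1
    from unicyclic_chord_closes_cycle[OF uni cyc 1 _ E_sym[OF assms(3)]] assms
    show ?thesis by (auto simp: g)
  next
    case 2
    from unicyclic_chord_closes_cycle[OF uni cyc 2 _ assms(3)] assms
    show ?thesis by (auto simp: g)
  qed
qed

lemma pendant_unique_neighbour:
  assumes "v < n" "v \<notin> set c"
  shows "\<exists>i<g. \<forall>u. E v u \<longleftrightarrow> u = c ! i"
proof -
  have c1: "card {u \<in> set c. E v u} = 1" and indep: "\<And>u. u < n \<Longrightarrow> u \<notin> set c \<Longrightarrow> \<not> E v u"
    using can cyc assms unfolding canonical_unicyclic_def by blast+
  from c1 obtain w where w: "{u \<in> set c. E v u} = {w}" by (auto simp: card_1_singleton_iff)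
  then have "w \<in> set c" by blast
  then obtain i where "i < g" "w = c ! i" by (auto simp: in_set_conv_nth g)
  moreover have "E v u \<longleftrightarrow> u = w" for u
    using w indep[of u] sg by (auto simp: signed_graph_def)
  ultimately show ?thesis by blast
qed

lemma pred_idx:
  assumes "i < g"
  obtains j where "j < g" "Suc j mod g = i"
proof (cases i)
  case 0
  then show thesis using assms by (intro that[of "g - 1"]) auto
next
  case (Suc j)
  then show thesis using assms by (intro that[of j]) auto
qed

text \<open>Uses that the cycle has length at least 3; it guarantees that the two cycle neighbours
  of a position are different vertices.\<close>

lemma Suc_mod_Suc_mod_neq:
  assumes "j < g"
  shows "Suc (Suc j mod g) mod g \<noteq> j"
  using assms cycle_facts(2) by (auto simp: mod_Suc)

text \<open>Without a pendant neighbour and without chords, only the successor and the predecessor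
  on the cycle are adjacent. Both signs are written along the orientation of
  \<open>c\<close>.\<close>

lemma row_sum_non_major:
  assumes j: "j < g" and i: "i = Suc j mod g" "i \<notin> major_idx n E c"
  shows "(\<Sum>u | E (c ! i) u. s (c ! i) u * x u) =
    s (c ! i) (c ! (Suc i mod g)) * x (c ! (Suc i mod g)) + s (c ! j) (c ! i) * x (c ! j)"
proof -
  have ig: "i < g" and k: "Suc i mod g < g" using i j by auto
  have "{u. E (c ! i) u} = {c ! (Suc i mod g), c ! j}"
  proof (intro equalityI subsetI)
    fix u assume "u \<in> {u. E (c ! i) u}"
    then have u: "E (c ! i) u" by simp
    then have "u < n" using sg by (auto simp: signed_graph_def)
    then have "u \<in> set c" using i(2) u ig by (auto simp: major_idx_def g)
    then obtain l where l: "l < g" "u = c ! l" by (auto simp: in_set_conv_nth g)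
    from cycle_edge_consecutive[OF ig l(1)] u l have "l = Suc i mod g \<or> i = Suc l mod g" by simp
    moreover have "i = Suc l mod g \<Longrightarrow> l = j"
      using i(1) l(1) j by (auto simp: mod_Suc split: if_splits)
    ultimately show "u \<in> {c ! (Suc i mod g), c ! j}" using l by auto
  next
    fix u assume "u \<in> {c ! (Suc i mod g), c ! j}"
    then show "u \<in> {u. E (c ! i) u}"
      using cycle_facts(4)[OF ig] E_sym[OF cycle_facts(4)[OF j]] i by auto
  qed
  moreover have "c ! (Suc i mod g) \<noteq> c ! j"
    using Suc_mod_Suc_mod_neq[OF j] nth_cycle_eq[OF k j] i by simp
  moreover have "s (c ! i) (c ! j) = s (c ! j) (c ! i)"
    using cycle_facts(4)[OF j] sg i by (auto simp: signed_graph_def)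
  ultimately show ?thesis by simp
qed

text \<open>The vertex cover criterion is applied to \<open>T\<close>, the major vertices and the
  positions \<open>K\<close> at even distance inside gaps, matched with \<open>U\<close>, one
  pendant per major vertex and the successor of each position in \<open>K\<close>.\<close>

lemma neg_inertia_with_pendants:
  assumes "set c \<noteq> {..<n}"
  shows "2 * neg_inertia (adj_mat n E s) =
    g + card {i \<in> major_idx n E c. even (gap_len (major_idx n E c) g i)}"
proof -
  define M where "M = major_idx n E c"
  let ?nx = "\<lambda>i. Suc i mod g"
  let ?e = "next_dist M g"
  have Mg: "M \<subseteq> {..<g}" by (auto simp: M_def major_idx_def g)
  have g0: "0 < g" using cycle_facts(2) by linarith
  obtain v where v: "v < n" "v \<notin> set c" using assms cycle_facts(3) by auto
  obtain i where i: "i < g" "E v (c ! i)" using pendant_unique_neighbour[OF v] by blast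
  then have "i \<in> M" using v E_sym by (auto simp: M_def major_idx_def g)
  then have M0: "M \<noteq> {}" by auto
  note rec = next_dist_rec[OF Mg M0] and bounds = next_dist_bounds[OF Mg M0]
  have "\<exists>v<n. v \<notin> set c \<and> E (c ! i) v" if "i \<in> M" for i
    using that by (auto simp: M_def major_idx_def)
  then obtain p where p: "\<And>i. i \<in> M \<Longrightarrow> p i < n \<and> p i \<notin> set c \<and> E (c ! i) (p i)" by metis
  have nbr_p: "u = c ! i" if "i \<in> M" "E (p i) u" for i u
    using pendant_unique_neighbour[of "p i"] p[OF that(1)] that(2) E_sym by metis
  have inj_p: "inj_on p M"
  proof (rule inj_onI)
    fix i j assume ij: "i \<in> M" "j \<in> M" "p i = p j"
    then have "c ! j = c ! i" using nbr_p[OF ij(1)] p[OF ij(2)] E_sym by metis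
    then show "i = j" using nth_cycle_eq ij Mg by auto
  qed
  define K where "K = {i. i < g \<and> i \<notin> M \<and> even (?e i)}"
  have K: "?nx i < g" "?nx i \<notin> M" "odd (?e (?nx i))" if "i \<in> K" for i
    using that rec[of i] g0 by (auto simp: K_def split: if_splits)
  define T where "T = (!) c ` (M \<union> K)"
  define U where "U = p ` M \<union> (!) c ` (?nx ` K)"
  have MK: "M \<union> K \<subseteq> {..<g}" using Mg by (auto simp: K_def)
  have fin: "finite M" "finite K" using MK finite_subset by auto
  have inj_c: "inj_on ((!) c) {..<g}" using nth_cycle_eq by (auto simp: inj_on_def)
  have "card T = card (M \<union> K)"
    unfolding T_def by (rule card_image[OF inj_on_subset[OF inj_c MK]])
  then have card_T: "card T = card (cover_idx M g)" by (simp add: cover_idx_def[OF Mg M0] K_def)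
  have "card (M \<union> K) = card M + card K"
    using fin by (intro card_Un_disjoint) (auto simp: K_def)
  moreover have "card U = card M + card K"
  proof -
    have "p i \<noteq> c ! ?nx j" if "i \<in> M" "j \<in> K" for i j
      using p[OF that(1)] K(1)[OF that(2)] nth_cycle_mem by metis
    then have "card U = card (p ` M) + card ((!) c ` (?nx ` K))"
      unfolding U_def using fin by (intro card_Un_disjoint) auto
    also have "card (p ` M) = card M" by (rule card_image[OF inj_p])
    also have "card ((!) c ` (?nx ` K)) = card (?nx ` K)"
      using K by (intro card_image inj_on_subset[OF inj_c]) auto
    also have "card (?nx ` K) = card K"
      using MK by (intro card_image inj_on_subset[OF bij_betw_imp_inj_on[OF bij_betw_Suc_mod[OF Mg M0]]]) auto
    finally show ?thesis .
  qed
  ultimately have card_U: "card U = card T" using \<open>card T = card (M \<union> K)\<close> by simp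
  have idx_T: "c ! i \<in> T \<longleftrightarrow> i \<in> M \<union> K" if "i < g" for i
    using that MK nth_cycle_eq by (auto simp: T_def)
  have "neg_inertia (adj_mat n E s) = card T"
  proof (rule neg_inertia_eq_vertex_cover[OF sg _ _ _ _ card_U])
    \<comment> \<open>A position outside the cover has odd distance, so its successor is either
      major or at even distance.\<close>
    have step: "i \<in> M \<union> K \<or> ?nx i \<in> M \<union> K" if "i < g" for i
      using that rec[OF that] g0 by (auto simp: K_def)
    have half: "u \<in> T \<or> v \<in> T" if uv: "E u v" and u: "u \<notin> set c" for u v
    proof -
      have "u < n" using uv sg by (auto simp: signed_graph_def)
      then obtain i where "i < g" "v = c ! i"
        using pendant_unique_neighbour[OF _ u] uv by blast
      moreover from this have "i \<in> M" using uv u E_sym \<open>u < n\<close> by (auto simp: M_def major_idx_def g)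
      ultimately show ?thesis by (simp add: T_def)
    qed
    show "vertex_cover E T"
      unfolding vertex_cover_def
    proof (intro allI impI)
      fix u v assume uv: "E u v"
      show "u \<in> T \<or> v \<in> T"
      proof (cases "u \<in> set c \<and> v \<in> set c")
        case True
        then obtain i j where ij: "i < g" "j < g" "u = c ! i" "v = c ! j"
          by (auto simp: in_set_conv_nth g)
        then show ?thesis
          using cycle_edge_consecutive[OF ij(1,2)] uv step[OF ij(1)] step[OF ij(2)] idx_T by metis
      next
        case False
        then show ?thesis using half[OF uv] half[OF E_sym[OF uv]] by blast
      qed
    qed
    show "T \<subseteq> {..<n}" using MK cycle_facts(3) nth_cycle_mem by (auto simp: T_def subset_eq)
    show "U \<subseteq> {..<n}" using p K(1) cycle_facts(3) nth_cycle_mem by (auto simp: U_def subset_eq)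
    show "T \<inter> U = {}"
    proof -
      have "c ! ?nx i \<notin> T" if "i \<in> K" for i
        using K[OF that] idx_T by (auto simp: K_def)
      moreover have "p i \<notin> T" if "i \<in> M" for i
        using p[OF that] MK nth_cycle_mem by (auto simp: T_def)
      ultimately show ?thesis by (auto simp: U_def)
    qed
    fix x :: "nat \<Rightarrow> real"
    assume x0: "\<And>v. v \<notin> U \<Longrightarrow> x v = 0"
      and row: "\<And>v. v \<in> T \<Longrightarrow> (\<Sum>u | E v u. s v u * x u) = 0"
    have in_U: "j \<in> ?nx ` K" if "c ! j \<in> U" "j < g" for j
    proof -
      have "c ! j \<notin> p ` M" using p nth_cycle_mem[OF that(2)] by (metis imageE)
      then show ?thesis using that K(1) nth_cycle_eq by (auto simp: U_def)
    qed
    \<comment> \<open>The gap is swept forwards: the distance falls along it, so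
      \<open>g - ?e j\<close> grows and the induction may use the position \<open>l\<close> two
      steps earlier. The row of the position \<open>i\<close> between them then kills the coordinate
      at \<open>j\<close>.\<close>
    have gap0: "x (c ! j) = 0" if "j < g" for j
      using that
    proof (induction "g - ?e j" arbitrary: j rule: less_induct)
      case less
      show ?case
      proof (cases "j \<in> ?nx ` K")
        case False
        then show ?thesis using in_U less.prems x0 by blast
      next
        case True
        then obtain i where i: "i \<in> K" "j = ?nx i" by auto
        then have ig: "i < g" "i \<notin> M" by (auto simp: K_def)
        obtain l where l: "l < g" "?nx l = i" using pred_idx[OF ig(1)] by metis
        have ei: "?e i = Suc (?e j)" using rec[OF ig(1)] K[OF i(1)] i by simp
        have el: "?e l = Suc (?e i)" using rec[OF l(1)] ig l by simp
        have "x (c ! l) = 0"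
          using el ei bounds[OF l(1)] by (intro less.hyps[OF _ l(1)]) linarith
        moreover have "(\<Sum>u | E (c ! i) u. s (c ! i) u * x u) = 0"
          using i by (intro row) (auto simp: T_def)
        ultimately have "s (c ! i) (c ! j) * x (c ! j) = 0"
          using row_sum_non_major[OF l(1), of i x] l(2) ig(2) i(2) by (simp add: M_def)
        then show ?thesis using sign_nonzero cycle_facts(4)[OF ig(1)] i(2) by auto
      qed
    qed
    \<comment> \<open>With all cycle coordinates gone, the row of a major vertex retains only its
      chosen pendant, since its other pendants lie outside \<open>U\<close>.\<close>
    have "x (p i) = 0" if i: "i \<in> M" for i
    proof -
      have "x u = 0" if u: "E (c ! i) u" "u \<noteq> p i" for u
      proof (cases "u \<in> U")
        case True
        then consider j where "j \<in> M" "u = p j" | j where "j \<in> K" "u = c ! ?nx j"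
          by (auto simp: U_def)
        then show ?thesis
        proof cases
          case 1
          then have "c ! i = c ! j" using nbr_p u E_sym by metis
          then have "i = j" using nth_cycle_eq i 1 Mg by auto
          then show ?thesis using 1 u by simp
        next
          case 2
          then show ?thesis using gap0 K by simp
        qed
      qed (use x0 in auto)
      moreover have "{u. E (c ! i) u} \<subseteq> {..<n}" using sg unfolding signed_graph_def by blast
      then have "finite {u. E (c ! i) u}" by (rule finite_subset) simp
      ultimately have "(\<Sum>u | E (c ! i) u. s (c ! i) u * x u) = s (c ! i) (p i) * x (p i)"
        using p[OF i] by (simp add: sum.remove[of _ "p i"])
      moreover have "(\<Sum>u | E (c ! i) u. s (c ! i) u * x u) = 0"
        using i by (intro row) (auto simp: T_def)
      ultimately show ?thesis using sign_nonzero p[OF i] by auto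
    qed
    then show "\<forall>v\<in>U. x v = 0" using gap0 K(1) by (auto simp: U_def)
  qed
  then show ?thesis using card_cover_idx[OF Mg M0] card_T by (simp add: M_def)
qed

section \<open>Switching the signs along the cycle\<close>

definition switch_sign :: "nat \<Rightarrow> real" where
  "switch_sign i = (\<Prod>k<i. s (c ! k) (c ! (Suc k mod g)))"

text \<open>Switching makes every edge positive on the way round. The index \<open>g\<close> is
  meaningful too: it returns to the vertex at position 0 but carries the sign of the whole
  cycle.\<close>

definition switched_coord :: "(nat \<Rightarrow> real) \<Rightarrow> nat \<Rightarrow> real" where
  "switched_coord x i = switch_sign i * x (c ! (i mod g))"

lemma edge_sign_square: "i < g \<Longrightarrow> s (c ! i) (c ! (Suc i mod g)) * s (c ! i) (c ! (Suc i mod g)) = 1"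
proof -
  assume "i < g"
  then have "s (c ! i) (c ! (Suc i mod g)) \<in> {1, -1}"
    using cycle_facts(4)[of i] sg unfolding signed_graph_def by blast
  then show ?thesis by auto
qed

lemma switch_sign_square: "i \<le> g \<Longrightarrow> switch_sign i * switch_sign i = 1"
proof (induction i)
  case (Suc i)
  let ?t = "s (c ! i) (c ! (Suc i mod g))"
  have "switch_sign (Suc i) * switch_sign (Suc i) = (switch_sign i * switch_sign i) * (?t * ?t)" by (simp add: switch_sign_def)
  then show ?case using Suc edge_sign_square[of i] by simp
qed (simp add: switch_sign_def)

lemma edge_sign_switch:
  assumes "i < g"
  shows "s (c ! i) (c ! (Suc i mod g)) = switch_sign i * switch_sign (Suc i)"
proof -
  have "switch_sign i * switch_sign (Suc i) = (switch_sign i * switch_sign i) * s (c ! i) (c ! (Suc i mod g))" by (simp add: switch_sign_def)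
  then show ?thesis using switch_sign_square[of i] assms by simp
qed

lemma balanced_iff_switch_sign: "balanced_cycle s c \<longleftrightarrow> switch_sign g = 1"
  unfolding balanced_cycle_def switch_sign_def by (simp add: g)

lemma switched_coord_wrap: "switched_coord x g = switch_sign g * switched_coord x 0"
  using cycle_facts(2) by (simp add: switched_coord_def) (simp add: switch_sign_def)

lemma linear_functional_switched_coord: "linear_functional (\<lambda>x. switched_coord x i)"
  by (simp add: linear_functional_def switched_coord_def algebra_simps)

lemma switched_coord_eq_0: "i < g \<Longrightarrow> switched_coord x i = 0 \<Longrightarrow> x (c ! i) = 0"
  using switch_sign_square[of i] by (auto simp: switched_coord_def)

section \<open>Graphs that are cycles\<close>

context
  assumes full: "set c = {..<n}"
begin

lemma n_eq_g: "n = g"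
  using distinct_card[OF cycle_facts(1)] full by (simp add: g)

lemma no_major: "major_idx n E c = {}"
  using full by (auto simp: major_idx_def)

lemma mat_app_cycle:
  assumes j: "j < g"
  shows "mat_app (adj_mat n E s) n x (c ! (Suc j mod g)) =
    s (c ! (Suc j mod g)) (c ! (Suc (Suc j mod g) mod g)) * x (c ! (Suc (Suc j mod g) mod g)) +
    s (c ! j) (c ! (Suc j mod g)) * x (c ! j)"
proof -
  have "Suc j mod g < g" using j by (intro mod_less_divisor) linarith
  then have "c ! (Suc j mod g) < n" using cycle_facts(3) nth_cycle_mem by blast
  then show ?thesis
    using mat_app_adj_mat[OF sg] row_sum_non_major[OF j refl] no_major by simp
qed

lemma sum_Suc_mod: "(\<Sum>j<g. f (Suc j mod g)) = (\<Sum>i<g. f i)" for f :: "nat \<Rightarrow> real"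
  using cycle_facts(2) by (intro sum.reindex_bij_betw bij_betw_Suc_mod[of "{0}"]) auto

lemma quad_form_cycle:
  "quad_form (adj_mat n E s) n x = 2 * (\<Sum>i<g. switched_coord x i * switched_coord x (Suc i))"
proof -
  let ?A = "adj_mat n E s" and ?nx = "\<lambda>i. Suc i mod g"
  define q where "q = (\<lambda>i. s (c ! i) (c ! ?nx i) * (x (c ! i) * x (c ! ?nx i)))"
  have "bij_betw ((!) c) {..<g} {..<n}"
    using bij_betw_nth[OF cycle_facts(1), of "{..<g}" "{..<n}"] full by (simp add: g)
  then have "quad_form ?A n x = (\<Sum>i<g. x (c ! i) * mat_app ?A n x (c ! i))"
    unfolding quad_form_def by (rule sum.reindex_bij_betw[symmetric])
  also have "\<dots> = (\<Sum>j<g. x (c ! ?nx j) * mat_app ?A n x (c ! ?nx j))"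
    by (rule sum_Suc_mod[symmetric])
  also have "\<dots> = (\<Sum>j<g. q (?nx j) + q j)"
    by (intro sum.cong refl) (simp add: mat_app_cycle q_def algebra_simps)
  also have "\<dots> = 2 * (\<Sum>j<g. q j)" by (simp add: sum.distrib sum_Suc_mod)
  also have "(\<Sum>j<g. q j) = (\<Sum>j<g. switched_coord x j * switched_coord x (Suc j))"
    by (intro sum.cong refl) (simp add: q_def switched_coord_def edge_sign_switch)
  finally show ?thesis .
qed

text \<open>These are the rows of the matrix in switched coordinates. The row at position 0 is the
  one that crosses the wrap and picks up the cycle sign.\<close>

lemma kernel_recurrence:
  assumes ker: "\<forall>v<n. mat_app (adj_mat n E s) n x v = 0"
  shows "Suc i < g \<Longrightarrow> switched_coord x (Suc (Suc i)) = - switched_coord x i"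
    and "switched_coord x 1 = - switch_sign g * switched_coord x (g - 1)"
proof -
  have row: "s (c ! (Suc j mod g)) (c ! (Suc (Suc j mod g) mod g)) * x (c ! (Suc (Suc j mod g) mod g)) +
    s (c ! j) (c ! (Suc j mod g)) * x (c ! j) = 0" if "j < g" for j
  proof -
    have "Suc j mod g < g" using that by (intro mod_less_divisor) linarith
    then have "c ! (Suc j mod g) < n" using cycle_facts(3) nth_cycle_mem by blast
    with ker mat_app_cycle[OF that, of x] show ?thesis by simp
  qed
  show "switched_coord x (Suc (Suc i)) = - switched_coord x i" if i: "Suc i < g"
  proof -
    have "switch_sign (Suc i) * (switch_sign (Suc (Suc i)) * x (c ! (Suc (Suc i) mod g)) + switch_sign i * x (c ! i)) = 0"
      using row[of i] i edge_sign_switch[of i] edge_sign_switch[of "Suc i"] by (simp add: algebra_simps)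
    moreover have "switch_sign (Suc i) \<noteq> 0" using switch_sign_square[of "Suc i"] i by auto
    ultimately show ?thesis using i by (simp add: switched_coord_def)
  qed
  have "Suc (g - 1) = g" using cycle_facts(2) by simp
  then have "switch_sign 1 * x (c ! 1) + switch_sign g * (switch_sign (g - 1) * x (c ! (g - 1))) = 0"
    using row[of "g - 1"] edge_sign_switch[of "g - 1"] edge_sign_switch[of 0] cycle_facts(2)
    by (simp add: mult_ac switch_sign_def[of 0])
  then show "switched_coord x 1 = - switch_sign g * switched_coord x (g - 1)"
    using cycle_facts(2) by (simp add: switched_coord_def)
qed

text \<open>Under the alternating conditions this sign is the coefficient of the square that remains
  in half the form for odd \<open>g\<close>. For even \<open>g\<close> the remaining coefficient
  \<open>switch_sign g + (- 1) ^ (g div 2 - 1)\<close> vanishes exactly when it is 1.\<close>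

abbreviation twist :: real where
  "twist \<equiv> switch_sign g * (- 1) ^ (g div 2)"

lemma twist_cases: "twist = 1 \<or> twist = -1"
proof -
  have "twist * twist = 1"
    using switch_sign_square[of g] by (simp add: mult_ac power_mult_distrib[symmetric])
  then show ?thesis by (simp add: square_eq_1_iff)
qed

text \<open>The range of \<open>j\<close> amounts to \<open>2 * j < g\<close> without the trivial
  case \<open>j = 0\<close>. This saves one condition compared with \<open>even_functionals\<close>,
  which is what separates the two values of \<open>twist\<close>.\<close>

definition alt_functionals :: "((nat \<Rightarrow> real) \<Rightarrow> real) set" where
  "alt_functionals = (\<lambda>j x. switched_coord x (2 * j) - (- 1) ^ j * switched_coord x 0) ` {1..<Suc g div 2}"

definition even_functionals :: "((nat \<Rightarrow> real) \<Rightarrow> real) set" where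
  "even_functionals = (\<lambda>j x. switched_coord x (2 * j)) ` {..<Suc g div 2}"

lemma linear_functional_alt: "F \<in> alt_functionals \<Longrightarrow> linear_functional F"
  unfolding alt_functionals_def linear_functional_def switched_coord_def
  by (elim imageE, hypsubst) (simp add: algebra_simps)

lemma linear_functional_even: "F \<in> even_functionals \<Longrightarrow> linear_functional F"
  unfolding even_functionals_def
  by (elim imageE, hypsubst) (rule linear_functional_switched_coord)

lemma finite_functionals: "finite alt_functionals" "finite even_functionals"
  unfolding alt_functionals_def even_functionals_def by (rule finite_imageI, simp)+

lemma card_alt_functionals: "card alt_functionals \<le> Suc g div 2 - 1"
  unfolding alt_functionals_def by (rule order.trans[OF card_image_le]) simp_all

lemma card_even_functionals: "card even_functionals \<le> Suc g div 2"
  unfolding even_functionals_def by (rule order.trans[OF card_image_le]) simp_all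

lemma alt_functionals_zero:
  assumes "\<forall>F\<in>alt_functionals. F x = 0" and "2 * j < g"
  shows "switched_coord x (2 * j) = (- 1) ^ j * switched_coord x 0"
proof (cases "j = 0")
  case False
  then have "(\<lambda>x. switched_coord x (2 * j) - (- 1) ^ j * switched_coord x 0) \<in> alt_functionals"
    unfolding alt_functionals_def using assms(2) by (intro imageI) auto
  from bspec[OF assms(1) this] show ?thesis by simp
qed simp

lemma quad_form_alt:
  assumes "\<forall>F\<in>alt_functionals. F x = 0"
  shows "quad_form (adj_mat n E s) n x = 2 * (if odd g then twist * (switched_coord x 0)\<^sup>2
    else (switch_sign g + (- 1) ^ (g div 2 - 1)) * switched_coord x (g - 1) * switched_coord x 0)"
proof -
  have "0 < g" using cycle_facts(2) by linarith
  from sum_alternating_evens[of g "switched_coord x" "switch_sign g", OF alt_functionals_zero[OF assms] switched_coord_wrap this]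
  show ?thesis unfolding quad_form_cycle by (rule arg_cong)
qed

lemma even_functionals_zero:
  assumes "\<forall>F\<in>even_functionals. F x = 0" and "2 * j < g"
  shows "switched_coord x (2 * j) = 0"
proof -
  have "(\<lambda>x. switched_coord x (2 * j)) \<in> even_functionals"
    unfolding even_functionals_def using assms(2) by (intro imageI) auto
  from bspec[OF assms(1) this] show ?thesis .
qed

text \<open>Vanishing even coordinates are the alternating pattern with initial value 0, so the same
  collapse applies.\<close>

lemma quad_form_even:
  assumes "\<And>j. 2 * j < g \<Longrightarrow> switched_coord x (2 * j) = 0"
  shows "quad_form (adj_mat n E s) n x = 0"
proof -
  have x0: "switched_coord x 0 = 0" using assms[of 0] cycle_facts(2) by simp
  have "switched_coord x (2 * j) = (- 1) ^ j * switched_coord x 0" if "2 * j < g" for j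
    using assms[OF that] x0 by simp
  from sum_alternating_evens[of g "switched_coord x" "switch_sign g", OF this switched_coord_wrap]
  show ?thesis unfolding quad_form_cycle using cycle_facts(2) x0 by simp
qed

lemma kernel_odds:
  assumes ker: "\<forall>v<n. mat_app (adj_mat n E s) n x v = 0" and "2 * j + 1 < g"
  shows "switched_coord x (2 * j + 1) = (- 1) ^ j * switched_coord x 1"
  using assms(2)
proof (induction j)
  case (Suc j)
  then show ?case using kernel_recurrence(1)[OF ker, of "2 * j + 1"] by simp
qed simp

text \<open>The odd coordinates alternate from the one at 1. Going once round the cycle returns that
  coordinate multiplied by \<open>twist\<close> for even \<open>g\<close>, so it is 0. For odd
  \<open>g\<close> it is, up to sign, the coordinate at the even index \<open>g - 1\<close>.\<close>

lemma kernel_even_zero: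
  assumes ker: "\<forall>v<n. mat_app (adj_mat n E s) n x v = 0" and tw: "twist = -1"
    and ev: "\<And>j. 2 * j < g \<Longrightarrow> switched_coord x (2 * j) = 0"
  shows "\<forall>v<n. x v = 0"
proof -
  have "switched_coord x 1 = 0"
  proof (cases "odd g")
    case True
    then have "switched_coord x (g - 1) = 0" using ev[of "g div 2"] cycle_facts(2) by simp
    then show ?thesis using kernel_recurrence(2)[OF ker] by simp
  next
    case False
    define h where "h = g div 2 - 1"
    then have gh: "g = 2 * Suc h" using False cycle_facts(2) by presburger
    have "switched_coord x (g - 1) = (- 1) ^ h * switched_coord x 1"
      using kernel_odds[OF ker, of h] gh by simp
    then have "switched_coord x 1 = - switch_sign g * (- 1) ^ h * switched_coord x 1"
      using kernel_recurrence(2)[OF ker] by simp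
    also have "- switch_sign g * (- 1) ^ h = twist" using gh by simp
    finally show ?thesis using tw by simp
  qed
  then have "switched_coord x i = 0" if "i < g" for i
    using ev[of "i div 2"] kernel_odds[OF ker, of "i div 2"] that by (cases "even i") auto
  then have "x (c ! i) = 0" if "i < g" for i using switched_coord_eq_0 that by blast
  then show ?thesis using full by (metis g in_set_conv_nth lessThan_iff)
qed

text \<open>If \<open>twist = 1\<close>, the alternating conditions make the form nonnegative and
  are too few for the value \<open>Suc g div 2\<close>. If \<open>twist = -1\<close>, the even
  conditions give that value as an upper bound, and the dual test shows that it is attained.\<close>

lemma neg_inertia_cycle:
  "neg_inertia (adj_mat n E s) = Suc g div 2 \<longleftrightarrow> twist = -1"
proof -
  let ?A = "adj_mat n E s"
  note sym = transpose_adj_mat[OF sg]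
  show ?thesis
  proof (cases "twist = -1")
    case False
    then have tw: "twist = 1" using twist_cases by blast
    have "neg_inertia ?A \<le> card alt_functionals"
    proof (rule neg_inertia_le[OF adj_mat_carrier sym finite_functionals(1) linear_functional_alt])
      fix x :: "nat \<Rightarrow> real" assume "\<And>F. F \<in> alt_functionals \<Longrightarrow> F x = 0"
      then have F: "\<forall>F\<in>alt_functionals. F x = 0" by blast
      show "0 \<le> quad_form ?A n x"
      proof (cases "odd g")
        case False
        define h where "h = g div 2 - 1"
        then have gh: "g div 2 = Suc h" using False cycle_facts(2) by presburger
        \<comment> \<open>The cycle sign cancels \<open>(- 1) ^ h\<close>, so the remaining
          coefficient is 0 and the form vanishes.\<close>
        have "switch_sign g * (- 1) ^ h * (- 1) ^ h = - ((- 1) ^ h)" using tw gh by simp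
        then have "switch_sign g = - ((- 1) ^ h)" by (simp add: mult.assoc power_mult_distrib[symmetric])
        then show ?thesis using quad_form_alt[OF F] False gh by simp
      qed (use quad_form_alt[OF F] tw in simp)
    qed
    then have "neg_inertia ?A < Suc g div 2" using card_alt_functionals cycle_facts(2) by linarith
    then show ?thesis using False by simp
  next
    case tw: True
    have "neg_inertia ?A \<le> card even_functionals"
    proof (rule neg_inertia_le[OF adj_mat_carrier sym finite_functionals(2) linear_functional_even])
      fix x :: "nat \<Rightarrow> real" assume "\<And>F. F \<in> even_functionals \<Longrightarrow> F x = 0"
      then have "\<forall>F\<in>even_functionals. F x = 0" by blast
      then show "0 \<le> quad_form ?A n x" using quad_form_even even_functionals_zero by simp
    qed
    then have upper: "neg_inertia ?A \<le> Suc g div 2" using card_even_functionals by linarith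
    \<comment> \<open>The number of conditions must be at most \<open>g - Suc g div 2\<close>: the
      alternating ones fit for odd \<open>g\<close>, the even ones for even
      \<open>g\<close>.\<close>
    have "Suc g div 2 \<le> neg_inertia ?A"
    proof (cases "odd g")
      case True
      have "n \<le> neg_inertia ?A + card alt_functionals"
      proof (rule neg_inertia_ge[OF adj_mat_carrier sym finite_functionals(1) linear_functional_alt])
        fix x :: "nat \<Rightarrow> real"
        assume "\<And>F. F \<in> alt_functionals \<Longrightarrow> F x = 0" and nonneg: "0 \<le> quad_form ?A n x"
          and ker: "quad_form ?A n x = 0 \<Longrightarrow> \<forall>i<n. mat_app ?A n x i = 0"
        then have F: "\<forall>F\<in>alt_functionals. F x = 0" by blast
        \<comment> \<open>Nonnegativity forces the coordinate at 0 to vanish, hence by alternation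
          all even ones. The form is then 0, so the vector lies in the kernel.\<close>
        have Q: "quad_form ?A n x = - 2 * (switched_coord x 0)\<^sup>2" using quad_form_alt[OF F] True tw by simp
        then have "switched_coord x 0 = 0" using nonneg by simp
        then show "\<forall>i<n. x i = 0"
          using kernel_even_zero[OF ker tw] alt_functionals_zero[OF F] Q by simp
      qed
      moreover from True obtain k where "g = 2 * k + 1" by (elim oddE)
      ultimately show ?thesis using card_alt_functionals n_eq_g by simp
    next
      case False
      have "n \<le> neg_inertia ?A + card even_functionals"
      proof (rule neg_inertia_ge[OF adj_mat_carrier sym finite_functionals(2) linear_functional_even])
        fix x :: "nat \<Rightarrow> real"
        assume "\<And>F. F \<in> even_functionals \<Longrightarrow> F x = 0"
          and ker: "quad_form ?A n x = 0 \<Longrightarrow> \<forall>i<n. mat_app ?A n x i = 0"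
        then have F: "\<forall>F\<in>even_functionals. F x = 0" by blast
        note ev = even_functionals_zero[OF F]
        show "\<forall>i<n. x i = 0" by (rule kernel_even_zero[OF ker[OF quad_form_even[OF ev]] tw ev])
      qed
      moreover from False obtain k where "g = 2 * k" by auto
      ultimately show ?thesis using card_even_functionals n_eq_g by simp
    qed
    then show ?thesis using upper tw by simp
  qed
qed

lemma twist_iff:
  "twist = -1 \<longleftrightarrow> (balanced_cycle s c \<and> g mod 4 \<in> {2, 3}) \<or> (\<not> balanced_cycle s c \<and> g mod 4 \<in> {0, 1})"
proof -
  have "switch_sign g = 1 \<or> switch_sign g = -1" using switch_sign_square[of g] by (simp add: square_eq_1_iff)
  moreover have "(- 1 :: real) ^ (g div 2) = (if g mod 4 \<in> {2, 3} then -1 else 1)"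
  proof -
    have "odd (g div 2) \<longleftrightarrow> g mod 4 \<in> {2, 3}" by (simp, presburger)
    then show ?thesis by auto
  qed
  moreover have "g mod 4 \<in> {2, 3} \<longleftrightarrow> g mod 4 \<notin> {0, 1}" by (simp, presburger)
  ultimately show ?thesis unfolding balanced_iff_switch_sign by auto
qed

end
end

section \<open>From the two counts to the ceiling of half the length\<close>

lemma ceiling_half: "\<lceil>real g / 2\<rceil> = int (Suc g div 2)"
proof (cases "even g")
  case True
  then show ?thesis by (auto elim!: evenE)
next
  case False
  then obtain k where "g = 2 * k + 1" by (auto elim!: oddE)
  then show ?thesis by (intro ceiling_unique) (auto simp: field_simps)
qed

theorem theorem3p2:
  fixes n :: nat and E :: "nat \<Rightarrow> nat \<Rightarrow> bool" and s :: "nat \<Rightarrow> nat \<Rightarrow> real"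
    and c :: "nat list" and g :: nat
  assumes "signed_graph n E s"
    and "canonical_unicyclic n E"
    and "cycle_list n E c"
    and "g = length c"
  shows "(set c = {..<n} \<longrightarrow>
           (int (neg_inertia (adj_mat n E s)) = \<lceil>real g / 2\<rceil> \<longleftrightarrow>
              (balanced_cycle s c \<and> g mod 4 \<in> {2, 3}) \<or>
              (\<not> balanced_cycle s c \<and> g mod 4 \<in> {0, 1})))
       \<and> (set c \<noteq> {..<n} \<longrightarrow>
           (g mod 4 \<in> {1, 3} \<longrightarrow>
              (int (neg_inertia (adj_mat n E s)) = \<lceil>real g / 2\<rceil> \<longleftrightarrow>
                 card {i \<in> major_idx n E c. even (gap_len (major_idx n E c) g i)} = 1))
         \<and> (g mod 4 \<in> {0, 2} \<longrightarrow>
              (int (neg_inertia (adj_mat n E s)) = \<lceil>real g / 2\<rceil> \<longleftrightarrow>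
                 (\<forall>i \<in> major_idx n E c. odd (gap_len (major_idx n E c) g i)))))"
proof (intro conjI impI)
  assume full: "set c = {..<n}"
  show "int (neg_inertia (adj_mat n E s)) = \<lceil>real g / 2\<rceil> \<longleftrightarrow>
      (balanced_cycle s c \<and> g mod 4 \<in> {2, 3}) \<or> (\<not> balanced_cycle s c \<and> g mod 4 \<in> {0, 1})"
    unfolding ceiling_half of_nat_eq_iff neg_inertia_cycle[OF assms full] by (rule twist_iff[OF assms full])
next
  assume "set c \<noteq> {..<n}"
  \<comment> \<open>Twice the inertia is \<open>g\<close> plus the number of even gaps. Reaching
    twice the ceiling requires a surplus of 1 for odd \<open>g\<close> and of 0 for even
    \<open>g\<close>.\<close>
  note count = neg_inertia_with_pendants[OF assms this]
  show "int (neg_inertia (adj_mat n E s)) = \<lceil>real g / 2\<rceil> \<longleftrightarrow>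
      card {i \<in> major_idx n E c. even (gap_len (major_idx n E c) g i)} = 1" if "g mod 4 \<in> {1, 3}"
  proof -
    have "g mod 4 = 1 \<or> g mod 4 = 3" using that by simp
    then have "odd g" by presburger
    then obtain k where "g = 2 * k + 1" by (elim oddE)
    then show ?thesis unfolding ceiling_half of_nat_eq_iff using count by auto
  qed
  show "int (neg_inertia (adj_mat n E s)) = \<lceil>real g / 2\<rceil> \<longleftrightarrow>
      (\<forall>i \<in> major_idx n E c. odd (gap_len (major_idx n E c) g i))" if "g mod 4 \<in> {0, 2}"
  proof -
    have "g mod 4 = 0 \<or> g mod 4 = 2" using that by simp
    then have "even g" by presburger
    then obtain k where "g = 2 * k" by (elim evenE)
    then have "neg_inertia (adj_mat n E s) = Suc g div 2 \<longleftrightarrow>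
        card {i \<in> major_idx n E c. even (gap_len (major_idx n E c) g i)} = 0"
      using count by auto
    moreover have "finite (major_idx n E c)" by (simp add: major_idx_def)
    ultimately show ?thesis unfolding ceiling_half of_nat_eq_iff by auto
  qed
qed

end
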